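(* Let $(\Phi,\mathfrak N,\mathfrak T,\mathfrak R,\mathfrak S,\phi_{\mathrm{start}},\Sigma,\mathrm{Lex},\mathrm{Sel})$ be a parameterized local lexing and $D\in\Sigma^*$. Then for all $0\le k\le|D|$ and all $u\ge0$: $\mathcal J_k^u\sim\mathcal J'^{\,u}_k$, $\mathcal U(\mathcal T_k^u)=\mathcal T'^{\,u}_k$, and $\mathcal I_k\sim\mathcal I'_k$; moreover $\mathfrak I\sim\mathfrak I'$.
   Context: $\Phi$ is a non-empty set; $\mathfrak N,\mathfrak T$ disjoint sets of nonterminals and terminals; $\mathfrak S\in\mathfrak N$, $\phi_{\mathrm{start}}\in\Phi$; $\mathfrak R$ a set of parameterized rules $N_{f_{k+1}}\to X_1^{f_1}\cdots X_k^{f_k}$ ($k\ge0$, $N\in\mathfrak N$, $X_i\in\mathfrak N\cup\mathfrak T$, partial $f_i:\Phi^{2i-1}\rightharpoonup\Phi$); $\Sigma$ a set of characters; $\mathrm{Lex}$ assigns to each $(t,\alpha,D,k)$ ($t\in\mathfrak T,\alpha\in\Phi,0\le k\le|D|$) a set of parameterized tokens $(t,\alpha,\beta,c)\in\mathfrak T\times\Phi\times\Phi\times\Sigma^*$ with $k+|c|\le|D|$, $c_i=D_{k+i}$ for $0\le i<|c|$; $\mathrm{Sel}$ maps pairs $(A,B)$ of sets of parameterized tokens to a set with $A\subseteq\mathrm{Sel}(A,B)\subseteq B$ whenever $A\subseteq B$. Sequences indexed from 0; juxtaposition is concatenation; $\mathrm{take}_n$ takes the first $n$ entries. $\langle f_1,\dots,f_u\rangle$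 is the set of $\rho\in\Phi^{2u}$ with $f_i$ defined at $(\rho_0,\dots,\rho_{2i-2})$ and $\rho_{2i-1}=f_i(\rho_0,\dots,\rho_{2i-2})$ for $i=1,\dots,u$. Induced grammar: nonterminals $(\mathfrak N\times\Phi\times\Phi)\cup\{\top,\bot\}$, terminals $\overline{\mathfrak T}=\mathfrak T\times\Phi\times\Phi$, triples written $X^\alpha_\beta$, start $\top$; rules $\overline{\mathfrak R}=\{\top\to\mathfrak S^{\phi_{\mathrm{start}}}_\beta\mid\beta\in\Phi\}\cup\bigcup_{r\in\mathfrak R}\overline r$, where for $r=N_{f_{k+1}}\to X_1^{f_1}\cdots X_k^{f_k}$, $\overline r$ consists of (i) rules $N^\alpha_\beta\to(X_1)^{\alpha_1}_{\beta_1}\cdots(X_k)^{\alpha_k}_{\beta_k}$ with $(\alpha,\alpha_1,\beta_1,\dots,\alpha_k,\beta_k,\beta)\in\langle f_1,\dots,f_{k+1}\rangle$, and (ii) rules $N^\alpha_\beta\to(X_1)^{\alpha_1}_{\beta_1}\cdots(X_h)^{\alpha_h}_{\beta_h}\bot$ with $1\le h\le k$, $\beta,\beta_h\in\Phi$, $(\alpha,\alpha_1,\beta_1,\dots,\alpha_h)\in\langle f_1,\dots,f_h\rangle$ and $f_{h+1}$ undefined at $(\alpha,\alpha_1,\beta_1,\dots,\alpha_h,\beta_h)$. Induced lexer $\overline{\mathrm{Lex}}(t^\alpha_\beta)(D,k)=\{(t^\alpha_\beta,c)\mid(t,\alpha,\beta,c)\in\mathrm{Lex}(t,\alpha,D,k)\}$;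 $\mathcal U(t,\alpha,\beta,c)=(t^\alpha_\beta,c)$ lifted to sets; $\overline{\mathrm{Sel}}(A,B)=\mathcal U(\mathrm{Sel}(\mathcal U^{-1}A,\mathcal U^{-1}B))$. Items: parameterized item $(r,d,i,j,\rho)$ with $r=N_{f_{v+1}}\to X_1^{f_1}\cdots X_v^{f_v}\in\mathfrak R$, $0\le d\le v$, $0\le i\le j\le|D|$, $\rho\in\langle f_1,\dots,f_{d+1}\rangle$. Ordinary item $(q,d,i,j)$ with $q=(L\to w)\in\overline{\mathfrak R}$, $0\le d\le|w|$, $0\le i\le j\le|D|$, written $(L\to w_1\bullet w_2,i,j)$, $|w_1|=d$. For $x=(r,d,i,j,\rho)$, $\overline x$ consists of all $(q,d,i,j)$ with $q\in\overline r$ of type (i) and $\mathrm{take}_{2(d+1)}(\alpha,\alpha_1,\beta_1,\dots,\alpha_k,\beta_k,\beta)=\rho$, and all $(q,d,i,j)$ with $q\in\overline r$ of type (ii), $d\le h-1$, $\mathrm{take}_{2(d+1)}(\alpha,\alpha_1,\beta_1,\dots,\alpha_h)=\rho$. $\overline I=\bigcup_{x\in I}\overline x$; $\mathrm{Norm}(I')=\{(L\to w_1\bullet w_2,i,j)\in I'\mid L\ne\top,\ w_2\text{ is not the one-symbol string }\bot\}$; $I\sim I'$ means $\overline I=\mathrm{Norm}(I')$. PELLA steps ($r=N_{f_{v+1}}\to X_1^{f_1}\cdots X_v^{f_v}$): $\mathrm{Init}=\{(r,0,0,0,(\phi_{\mathrm{start}},f_1(\phi_{\mathrm{start}})))\mid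 r\text{ has left side }\mathfrak S,\ f_1\text{ defined at }\phi_{\mathrm{start}}\}$; $\mathrm{Predict}\,k\,I=I\cup\{(r',0,k,k,(\rho_{2d+1},g_1(\rho_{2d+1})))\mid(r,d,i,k,\rho)\in I,d<v,X_{d+1}=M,\ r'=M_{g_{u+1}}\to Y_1^{g_1}\cdots Y_u^{g_u}\in\mathfrak R,\ g_1\text{ defined at }\rho_{2d+1}\}$; $\mathrm{Complete}\,k\,I=I\cup\{(r,d+1,i,k,\rho'\,f_{d+2}(\rho'))\mid(r,d,i,j,\rho)\in I,d<v,X_{d+1}=M,\ (r',u,j,k,\xi)\in I\text{ with }r'=M_{g_{u+1}}\to Y_1^{g_1}\cdots Y_u^{g_u},\ \rho_{2d+1}=\xi_0,\ \rho'=\rho\,\xi_{2u+1},\ f_{d+2}\text{ defined at }\rho'\}$; $\mathrm{Tokens}\,T\,k\,I=\mathrm{Sel}(T,\{x\mid(r,d,i,k,\rho)\in I,d<v,X_{d+1}\in\mathfrak T,x\in\mathrm{Lex}(X_{d+1},\rho_{2d+1},D,k)\})$; $\mathrm{Scan}\,T\,k\,I=I\cup\{(r,d+1,i,k+|c|,\rho'\,f_{d+2}(\rho'))\mid(r,d,i,k,\rho)\in I,d<v,(X_{d+1},\rho_{2d+1},\beta,c)\in T,\rho'=\rho\,\beta,f_{d+2}\text{ defined at }\rho'\}$. ELLA steps: $\mathrm{Init}'=\{(\top\to\bullet w,0,0)\mid(\top\to w)\in\overline{\mathfrak R}\}$; $\mathrm{Predict}'\,k\,I'=I'\cup\{(M\to\bullet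 w,k,k)\mid(L\to a\bullet M\,b,i,k)\in I',(M\to w)\in\overline{\mathfrak R}\}$; $\mathrm{Complete}'\,k\,I'=I'\cup\{(L\to a\,M\bullet b,i,k)\mid(L\to a\bullet M\,b,i,j)\in I',(M\to w\bullet,j,k)\in I'\}$; $\mathrm{Tokens}'\,T'\,k\,I'=\overline{\mathrm{Sel}}(T',\{x\mid(L\to a\bullet t\,b,i,k)\in I',t\in\overline{\mathfrak T},x\in\overline{\mathrm{Lex}}(t)(D,k)\})$; $\mathrm{Scan}'\,T'\,k\,I'=I'\cup\{(L\to a\,t\bullet b,i,k+|c|)\mid(L\to a\bullet t\,b,i,k)\in I',(t,c)\in T'\}$. Equations (with $\mathrm{limit}\,f\,X=\bigcup_{n\ge0}f^n(X)$): $\pi_k\,T\,I=\mathrm{limit}(\mathrm{Scan}\,T\,k\circ\mathrm{Complete}\,k\circ\mathrm{Predict}\,k)\,I$; $\mathcal J_0^0=\pi_0\,\emptyset\,\mathrm{Init}$; $\mathcal T_k^0=\emptyset$; $\mathcal T_k^{u+1}=\mathrm{Tokens}\,\mathcal T_k^u\,k\,\mathcal J_k^u$; $\mathcal J_k^{u+1}=\pi_k\,\mathcal T_k^{u+1}\,\mathcal J_k^u$; $\mathcal I_k=\bigcup_{u\ge0}\mathcal J_k^u$; $\mathcal J_{k+1}^0=\pi_{k+1}\,\emptyset\,\mathcal I_k$; $\mathfrak I=\mathcal I_{|D|}$. The primed objects $\pi'_k,\mathcal J'^{\,u}_k,\mathcal T'^{\,u}_k,\mathcal I'_k,\mathfrak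 I'$ are defined by the same equations with $\mathrm{Init}',\mathrm{Predict}',\mathrm{Complete}',\mathrm{Tokens}',\mathrm{Scan}'$ in place of the unprimed steps. *)

theory Defs
  imports Main
begin

section \<open>Parameterized local lexings\<close>

text \<open>A partial function \<open>\<Phi>\<^sup>n \<rightharpoonup> \<Phi>\<close> is a map on lists whose domain consists of
  lists of length \<open>n\<close> over \<open>\<Phi>\<close>; the value \<open>None\<close> means undefined.\<close>

type_synonym 'p pfun = "'p list \<rightharpoonup> 'p"

definition is_pfun :: "'p set \<Rightarrow> nat \<Rightarrow> 'p pfun \<Rightarrow> bool" where
  "is_pfun \<Phi> n f \<longleftrightarrow> dom f \<subseteq> {xs \<in> lists \<Phi>. length xs = n} \<and> ran f \<subseteq> \<Phi>"

text \<open>\<open>PRule N [(X\<^sub>1, f\<^sub>1), \<dots>, (X\<^sub>k, f\<^sub>k)] g\<close> is the rule with left side \<open>N\<close>, where \<open>g\<close>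
  is the subscript \<open>f\<^bsub>k+1\<^esub>\<close> of \<open>N\<close>. Lists are indexed from 0, so \<open>f\<^sub>i\<close> is \<open>pfuns r ! (i - 1)\<close>
  and \<open>X\<^sub>i\<close> is \<open>syms r ! (i - 1)\<close>.\<close>

datatype ('s, 'p) prule = PRule (lhs: 's) (rhs: "('s \<times> 'p pfun) list") (outfun: "'p pfun")

definition syms :: "('s, 'p) prule \<Rightarrow> 's list" where
  "syms r = map fst (rhs r)"

definition pfuns :: "('s, 'p) prule \<Rightarrow> 'p pfun list" where
  "pfuns r = map snd (rhs r) @ [outfun r]"

abbreviation arity :: "('s, 'p) prule \<Rightarrow> nat" where
  "arity r \<equiv> length (syms r)"

type_synonym ('s, 'p, 'c) ptoken = "'s \<times> 'p \<times> 'p \<times> 'c list"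

record ('s, 'p, 'c) pll =
  Phi :: "'p set"
  Nonterms :: "'s set"
  Terms :: "'s set"
  Rules :: "('s, 'p) prule set"
  Start :: 's
  phi_start :: 'p
  Chars :: "'c set"
  Lex :: "'s \<Rightarrow> 'p \<Rightarrow> 'c list \<Rightarrow> nat \<Rightarrow> ('s, 'p, 'c) ptoken set"
  Sel :: "('s, 'p, 'c) ptoken set \<Rightarrow> ('s, 'p, 'c) ptoken set \<Rightarrow> ('s, 'p, 'c) ptoken set"

definition ptokens :: "('s, 'p, 'c) pll \<Rightarrow> ('s, 'p, 'c) ptoken set" where
  "ptokens G = Terms G \<times> Phi G \<times> Phi G \<times> lists (Chars G)"

definition wf_prule :: "('s, 'p, 'c) pll \<Rightarrow> ('s, 'p) prule \<Rightarrow> bool" where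
  "wf_prule G r \<longleftrightarrow>
     lhs r \<in> Nonterms G \<and>
     set (syms r) \<subseteq> Nonterms G \<union> Terms G \<and>
     (\<forall>i\<in>{1..arity r + 1}. is_pfun (Phi G) (2 * i - 1) (pfuns r ! (i - 1)))"

definition parameterized_local_lexing :: "('s, 'p, 'c) pll \<Rightarrow> bool" where
  "parameterized_local_lexing G \<longleftrightarrow>
     Phi G \<noteq> {} \<and>
     Nonterms G \<inter> Terms G = {} \<and>
     (\<forall>r\<in>Rules G. wf_prule G r) \<and>
     Start G \<in> Nonterms G \<and>
     phi_start G \<in> Phi G \<and>
     (\<forall>t\<in>Terms G. \<forall>\<alpha>\<in>Phi G. \<forall>D\<in>lists (Chars G). \<forall>k\<le>length D.
        Lex G t \<alpha> D k \<subseteq>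
          {(t, \<alpha>, \<beta>, c) | \<beta> c. (t, \<alpha>, \<beta>, c) \<in> ptokens G \<and>
             k + length c \<le> length D \<and> (\<forall>i<length c. c ! i = D ! (k + i))}) \<and>
     (\<forall>A B. A \<subseteq> B \<longrightarrow> B \<subseteq> ptokens G \<longrightarrow> A \<subseteq> Sel G A B \<and> Sel G A B \<subseteq> B)"

text \<open>\<open>angle \<Phi> [f\<^sub>1, \<dots>, f\<^sub>u]\<close> is \<open>\<langle>f\<^sub>1, \<dots>, f\<^sub>u\<rangle>\<close>.\<close>

definition angle :: "'p set \<Rightarrow> 'p pfun list \<Rightarrow> 'p list set" where
  "angle \<Phi> fs = {\<rho> \<in> lists \<Phi>. length \<rho> = 2 * length fs \<and>
     (\<forall>i\<in>{1..length fs}. (fs ! (i - 1)) (take (2 * i - 1) \<rho>) = Some (\<rho> ! (2 * i - 1)))}"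


section \<open>The induced local lexing\<close>

datatype ('s, 'p) isym = Sym 's 'p 'p | Top | Bot

type_synonym ('s, 'p) irule = "('s, 'p) isym \<times> ('s, 'p) isym list"

type_synonym ('s, 'p, 'c) itoken = "('s, 'p) isym \<times> 'c list"

text \<open>\<open>decorate [X\<^sub>1, \<dots>, X\<^sub>h] (\<alpha>, \<alpha>\<^sub>1, \<beta>\<^sub>1, \<dots>, \<alpha>\<^sub>h, \<beta>\<^sub>h, \<dots>)\<close> is the list of the symbols \<open>X\<^sub>i\<close> with
  parameters \<open>\<alpha>\<^sub>i\<close> and \<open>\<beta>\<^sub>i\<close>, the entries \<open>2i - 1\<close> and \<open>2i\<close> of the parameter list.\<close>

definition decorate :: "'s list \<Rightarrow> 'p list \<Rightarrow> ('s, 'p) isym list" where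
  "decorate Xs \<sigma> = map (\<lambda>i. Sym (Xs ! (i - 1)) (\<sigma> ! (2 * i - 1)) (\<sigma> ! (2 * i))) [1..<length Xs + 1]"

text \<open>Type (i), with \<open>\<sigma> = (\<alpha>, \<alpha>\<^sub>1, \<beta>\<^sub>1, \<dots>, \<alpha>\<^sub>k, \<beta>\<^sub>k, \<beta>)\<close>.\<close>

definition params_i :: "('s, 'p, 'c) pll \<Rightarrow> ('s, 'p) prule \<Rightarrow> 'p list \<Rightarrow> bool" where
  "params_i G r \<sigma> \<longleftrightarrow> \<sigma> \<in> angle (Phi G) (pfuns r)"

definition rule_i :: "('s, 'p) prule \<Rightarrow> 'p list \<Rightarrow> ('s, 'p) irule" where
  "rule_i r \<sigma> = (Sym (lhs r) (hd \<sigma>) (last \<sigma>), decorate (syms r) \<sigma>)"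

text \<open>Type (ii), with \<open>\<tau> = (\<alpha>, \<alpha>\<^sub>1, \<beta>\<^sub>1, \<dots>, \<alpha>\<^sub>h)\<close> and \<open>b = \<beta>\<^sub>h\<close>.\<close>

definition params_ii ::
  "('s, 'p, 'c) pll \<Rightarrow> ('s, 'p) prule \<Rightarrow> nat \<Rightarrow> 'p list \<Rightarrow> 'p \<Rightarrow> 'p \<Rightarrow> bool" where
  "params_ii G r h \<tau> b \<beta> \<longleftrightarrow>
     1 \<le> h \<and> h \<le> arity r \<and> \<beta> \<in> Phi G \<and> b \<in> Phi G \<and>
     \<tau> \<in> angle (Phi G) (take h (pfuns r)) \<and> (pfuns r ! h) (\<tau> @ [b]) = None"

definition rule_ii :: "('s, 'p) prule \<Rightarrow> nat \<Rightarrow> 'p list \<Rightarrow> 'p \<Rightarrow> 'p \<Rightarrow> ('s, 'p) irule" where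
  "rule_ii r h \<tau> b \<beta> = (Sym (lhs r) (hd \<tau>) \<beta>, decorate (take h (syms r)) (\<tau> @ [b]) @ [Bot])"

definition rule_bar :: "('s, 'p, 'c) pll \<Rightarrow> ('s, 'p) prule \<Rightarrow> ('s, 'p) irule set" where
  "rule_bar G r =
     {rule_i r \<sigma> | \<sigma>. params_i G r \<sigma>} \<union>
     {rule_ii r h \<tau> b \<beta> | h \<tau> b \<beta>. params_ii G r h \<tau> b \<beta>}"

definition Rules_bar :: "('s, 'p, 'c) pll \<Rightarrow> ('s, 'p) irule set" where
  "Rules_bar G =
     {(Top, [Sym (Start G) (phi_start G) \<beta>]) | \<beta>. \<beta> \<in> Phi G} \<union> (\<Union>r\<in>Rules G. rule_bar G r)"

definition Terms_bar :: "('s, 'p, 'c) pll \<Rightarrow> ('s, 'p) isym set" where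
  "Terms_bar G = {Sym t \<alpha> \<beta> | t \<alpha> \<beta>. t \<in> Terms G \<and> \<alpha> \<in> Phi G \<and> \<beta> \<in> Phi G}"

text \<open>Only arguments in \<open>Terms_bar G\<close> matter for the induced lexer.\<close>

fun Lex_bar :: "('s, 'p, 'c) pll \<Rightarrow> ('s, 'p) isym \<Rightarrow> 'c list \<Rightarrow> nat \<Rightarrow> ('s, 'p, 'c) itoken set" where
  "Lex_bar G (Sym t \<alpha> \<beta>) D k = {(Sym t \<alpha> \<beta>, c) | c. (t, \<alpha>, \<beta>, c) \<in> Lex G t \<alpha> D k}"
| "Lex_bar G _ D k = {}"

fun untag :: "('s, 'p, 'c) ptoken \<Rightarrow> ('s, 'p, 'c) itoken" where
  "untag (t, \<alpha>, \<beta>, c) = (Sym t \<alpha> \<beta>, c)"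

definition Sel_bar ::
  "('s, 'p, 'c) pll \<Rightarrow> ('s, 'p, 'c) itoken set \<Rightarrow> ('s, 'p, 'c) itoken set \<Rightarrow> ('s, 'p, 'c) itoken set"
  where "Sel_bar G A B = untag ` Sel G (untag -` A) (untag -` B)"


section \<open>Items\<close>

text \<open>Items are tuples without built-in side conditions; for a parameterized local lexing and
  \<open>D\<close> over its characters, every tuple in the sets \<open>J_set\<close> below with \<open>k \<le> |D|\<close> satisfies them, i.e. \<open>r \<in> Rules G\<close>, \<open>d \<le> arity r\<close>, \<open>i \<le> j \<le> |D|\<close> and
  \<open>\<rho> \<in> \<langle>f\<^sub>1, \<dots>, f\<^bsub>d+1\<^esub>\<rangle>\<close> for parameterized items \<open>(r, d, i, j, \<rho>)\<close>, and \<open>q \<in> Rules_bar G\<close>,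
  \<open>d \<le> |w|\<close>, \<open>i \<le> j \<le> |D|\<close> for ordinary items \<open>(q, d, i, j)\<close> with \<open>q = (L, w)\<close>. The ordinary item
  \<open>(L \<rightarrow> w\<^sub>1 \<bullet> w\<^sub>2, i, j)\<close> is \<open>((L, w\<^sub>1 @ w\<^sub>2), length w\<^sub>1, i, j)\<close>.\<close>

type_synonym ('s, 'p) pitem = "('s, 'p) prule \<times> nat \<times> nat \<times> nat \<times> 'p list"

type_synonym ('s, 'p) item = "('s, 'p) irule \<times> nat \<times> nat \<times> nat"

fun item_bar :: "('s, 'p, 'c) pll \<Rightarrow> ('s, 'p) pitem \<Rightarrow> ('s, 'p) item set" where
  "item_bar G (r, d, i, j, \<rho>) =
     {(rule_i r \<sigma>, d, i, j) | \<sigma>. params_i G r \<sigma> \<and> take (2 * (d + 1)) \<sigma> = \<rho>} \<union>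
     {(rule_ii r h \<tau> b \<beta>, d, i, j) | h \<tau> b \<beta>.
        params_ii G r h \<tau> b \<beta> \<and> d \<le> h - 1 \<and> take (2 * (d + 1)) \<tau> = \<rho>}"

definition items_bar :: "('s, 'p, 'c) pll \<Rightarrow> ('s, 'p) pitem set \<Rightarrow> ('s, 'p) item set" where
  "items_bar G I = (\<Union>x\<in>I. item_bar G x)"

definition Norm :: "('s, 'p) item set \<Rightarrow> ('s, 'p) item set" where
  "Norm I' = {((L, w1 @ w2), length w1, i, j) | L w1 w2 i j.
     ((L, w1 @ w2), length w1, i, j) \<in> I' \<and> L \<noteq> Top \<and> w2 \<noteq> [Bot]}"

definition sim :: "('s, 'p, 'c) pll \<Rightarrow> ('s, 'p) pitem set \<Rightarrow> ('s, 'p) item set \<Rightarrow> bool" where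
  "sim G I I' \<longleftrightarrow> items_bar G I = Norm I'"


section \<open>The parsing equations\<close>

record ('tok, 'it) steps =
  step_init :: "'it set"
  step_predict :: "nat \<Rightarrow> 'it set \<Rightarrow> 'it set"
  step_complete :: "nat \<Rightarrow> 'it set \<Rightarrow> 'it set"
  step_tokens :: "'tok set \<Rightarrow> nat \<Rightarrow> 'it set \<Rightarrow> 'tok set"
  step_scan :: "'tok set \<Rightarrow> nat \<Rightarrow> 'it set \<Rightarrow> 'it set"

definition limit :: "('a set \<Rightarrow> 'a set) \<Rightarrow> 'a set \<Rightarrow> 'a set" where
  "limit f X = (\<Union>n. (f ^^ n) X)"

definition pi_step :: "('tok, 'it) steps \<Rightarrow> nat \<Rightarrow> 'tok set \<Rightarrow> 'it set \<Rightarrow> 'it set" where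
  "pi_step S k T I = limit (step_scan S T k \<circ> step_complete S k \<circ> step_predict S k) I"

function (sequential)
  T_set :: "('tok, 'it) steps \<Rightarrow> nat \<Rightarrow> nat \<Rightarrow> 'tok set" and
  J_set :: "('tok, 'it) steps \<Rightarrow> nat \<Rightarrow> nat \<Rightarrow> 'it set"
where
  "T_set S k 0 = {}"
| "T_set S k (Suc u) = step_tokens S (T_set S k u) k (J_set S k u)"
| "J_set S 0 0 = pi_step S 0 {} (step_init S)"
| "J_set S (Suc k) 0 = pi_step S (Suc k) {} (\<Union>u. J_set S k u)"
| "J_set S k (Suc u) = pi_step S k (T_set S k (Suc u)) (J_set S k u)"
  by pat_completeness auto
termination
  by (relation "measures [\<lambda>x. case x of Inl (S, k, u) \<Rightarrow> k | Inr (S, k, u) \<Rightarrow> k,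
                          \<lambda>x. case x of Inl (S, k, u) \<Rightarrow> u | Inr (S, k, u) \<Rightarrow> u,
                          \<lambda>x. case x of Inl _ \<Rightarrow> 0 | Inr _ \<Rightarrow> 1]") auto

definition I_set :: "('tok, 'it) steps \<Rightarrow> nat \<Rightarrow> 'it set" where
  "I_set S k = (\<Union>u. J_set S k u)"

definition result_set :: "('tok, 'it) steps \<Rightarrow> 'c list \<Rightarrow> 'it set" where
  "result_set S D = I_set S (length D)"


section \<open>PELLA\<close>

definition PInit :: "('s, 'p, 'c) pll \<Rightarrow> ('s, 'p) pitem set" where
  "PInit G = {(r, 0, 0, 0, [phi_start G, a]) | r a.
     r \<in> Rules G \<and> lhs r = Start G \<and> (pfuns r ! 0) [phi_start G] = Some a}"

definition PPredict :: "('s, 'p, 'c) pll \<Rightarrow> nat \<Rightarrow> ('s, 'p) pitem set \<Rightarrow> ('s, 'p) pitem set" where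
  "PPredict G k I = I \<union>
     {(r', 0, k, k, [\<rho> ! (2 * d + 1), a]) | r' r d i \<rho> a.
        (r, d, i, k, \<rho>) \<in> I \<and> d < arity r \<and>
        r' \<in> Rules G \<and> syms r ! d = lhs r' \<and>
        (pfuns r' ! 0) [\<rho> ! (2 * d + 1)] = Some a}"

definition PComplete :: "nat \<Rightarrow> ('s, 'p) pitem set \<Rightarrow> ('s, 'p) pitem set" where
  "PComplete k I = I \<union>
     {(r, d + 1, i, k, \<rho>' @ [a]) | r d i j \<rho> r' u \<xi> \<rho>' a.
        (r, d, i, j, \<rho>) \<in> I \<and> d < arity r \<and>
        (r', u, j, k, \<xi>) \<in> I \<and> syms r ! d = lhs r' \<and> u = arity r' \<and>
        \<rho> ! (2 * d + 1) = \<xi> ! 0 \<and> \<rho>' = \<rho> @ [\<xi> ! (2 * u + 1)] \<and>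
        (pfuns r ! (d + 1)) \<rho>' = Some a}"

definition PTokens ::
  "('s, 'p, 'c) pll \<Rightarrow> 'c list \<Rightarrow> ('s, 'p, 'c) ptoken set \<Rightarrow> nat \<Rightarrow> ('s, 'p) pitem set
   \<Rightarrow> ('s, 'p, 'c) ptoken set" where
  "PTokens G D T k I = Sel G T
     {x. \<exists>r d i \<rho>. (r, d, i, k, \<rho>) \<in> I \<and> d < arity r \<and> syms r ! d \<in> Terms G \<and>
           x \<in> Lex G (syms r ! d) (\<rho> ! (2 * d + 1)) D k}"

definition PScan ::
  "('s, 'p, 'c) ptoken set \<Rightarrow> nat \<Rightarrow> ('s, 'p) pitem set \<Rightarrow> ('s, 'p) pitem set" where
  "PScan T k I = I \<union>
     {(r, d + 1, i, k + length c, \<rho>' @ [a]) | r d i \<rho> \<beta> c \<rho>' a.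
        (r, d, i, k, \<rho>) \<in> I \<and> d < arity r \<and>
        (syms r ! d, \<rho> ! (2 * d + 1), \<beta>, c) \<in> T \<and>
        \<rho>' = \<rho> @ [\<beta>] \<and> (pfuns r ! (d + 1)) \<rho>' = Some a}"

definition pella :: "('s, 'p, 'c) pll \<Rightarrow> 'c list \<Rightarrow> (('s, 'p, 'c) ptoken, ('s, 'p) pitem) steps" where
  "pella G D = \<lparr>step_init = PInit G, step_predict = PPredict G, step_complete = PComplete,
     step_tokens = PTokens G D, step_scan = PScan\<rparr>"


section \<open>ELLA for the induced local lexing\<close>

definition EInit :: "('s, 'p, 'c) pll \<Rightarrow> ('s, 'p) item set" where
  "EInit G = {((Top, w), 0, 0, 0) | w. (Top, w) \<in> Rules_bar G}"

definition EPredict :: "('s, 'p, 'c) pll \<Rightarrow> nat \<Rightarrow> ('s, 'p) item set \<Rightarrow> ('s, 'p) item set" where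
  "EPredict G k I' = I' \<union>
     {((M, w), 0, k, k) | M w L a b i.
        ((L, a @ [M] @ b), length a, i, k) \<in> I' \<and> (M, w) \<in> Rules_bar G}"

definition EComplete :: "nat \<Rightarrow> ('s, 'p) item set \<Rightarrow> ('s, 'p) item set" where
  "EComplete k I' = I' \<union>
     {((L, a @ [M] @ b), length (a @ [M]), i, k) | L a M b i j w.
        ((L, a @ [M] @ b), length a, i, j) \<in> I' \<and> ((M, w), length w, j, k) \<in> I'}"

definition ETokens ::
  "('s, 'p, 'c) pll \<Rightarrow> 'c list \<Rightarrow> ('s, 'p, 'c) itoken set \<Rightarrow> nat \<Rightarrow> ('s, 'p) item set
   \<Rightarrow> ('s, 'p, 'c) itoken set" where
  "ETokens G D T' k I' = Sel_bar G T'
     {x. \<exists>L a t b i. ((L, a @ [t] @ b), length a, i, k) \<in> I' \<and> t \<in> Terms_bar G \<and>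
           x \<in> Lex_bar G t D k}"

definition EScan :: "('s, 'p, 'c) itoken set \<Rightarrow> nat \<Rightarrow> ('s, 'p) item set \<Rightarrow> ('s, 'p) item set" where
  "EScan T' k I' = I' \<union>
     {((L, a @ [t] @ b), length (a @ [t]), i, k + length c) | L a t b i c.
        ((L, a @ [t] @ b), length a, i, k) \<in> I' \<and> (t, c) \<in> T'}"

definition ella :: "('s, 'p, 'c) pll \<Rightarrow> 'c list \<Rightarrow> (('s, 'p, 'c) itoken, ('s, 'p) item) steps" where
  "ella G D = \<lparr>step_init = EInit G, step_predict = EPredict G, step_complete = EComplete,
     step_tokens = ETokens G D, step_scan = EScan\<rparr>"

end

theory Submission imports Defs begin

text \<open>The two inclusions behind \<open>\<sim>\<close> are transported separately through the steps, because
  they need different invariants and because they do not hold at the same time initially: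
  \<open>Init'\<close> has only items with left side \<open>\<top>\<close>, and the image of \<open>Init\<close> is reached after one
  prediction. The inclusion from PELLA to ELLA rests on the fact that a parameterized item
  \<open>(r, d, i, j, \<rho>)\<close> with \<open>d < v\<close> induces, for every \<open>\<beta> \<in> \<Phi>\<close>, an item whose next symbol has
  lower parameter \<open>\<beta>\<close>: extend \<open>\<rho> \<beta>\<close> as long as the functions of \<open>r\<close> are defined; this ends with a
  rule of type (ii) or, after the last symbol, of type (i).\<close>

subsection \<open>Parameter lists and induced rules\<close>

lemma length_pfuns [simp]: "length (pfuns r) = Suc (arity r)"
  by (simp add: pfuns_def syms_def)

lemma length_decorate [simp]: "length (decorate Xs \<sigma>) = length Xs"
  by (simp add: decorate_def del: upt_Suc)

lemma nth_decorate:
  "i < length Xs \<Longrightarrow> decorate Xs \<sigma> ! i = Sym (Xs ! i) (\<sigma> ! (2 * i + 1)) (\<sigma> ! (2 * i + 2))"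
  by (simp add: decorate_def nth_append del: upt_Suc)

lemma Sym_in_set_decorate: "x \<in> set (decorate Xs \<sigma>) \<Longrightarrow> \<exists>X \<alpha> \<beta>. x = Sym X \<alpha> \<beta>"
  by (auto simp: decorate_def)

text \<open>Shifting the index by one trades the truncated subtractions of \<open>angle_def\<close>
  for indices counted from 0, the form used below.\<close>

lemma angle_iff:
  "\<rho> \<in> angle \<Phi> fs \<longleftrightarrow> \<rho> \<in> lists \<Phi> \<and> length \<rho> = 2 * length fs \<and>
     (\<forall>i<length fs. (fs ! i) (take (2 * i + 1) \<rho>) = Some (\<rho> ! (2 * i + 1)))"
proof -
  have "(\<forall>i\<in>{1..n}. P (i - 1) (2 * i - 1)) \<longleftrightarrow> (\<forall>i<n. P i (2 * i + 1))"
    for n and P :: "nat \<Rightarrow> nat \<Rightarrow> bool"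
  proof (intro iffI ballI allI impI)
    fix i assume "\<forall>i\<in>{1..n}. P (i - 1) (2 * i - 1)" "i < n"
    from bspec[OF this(1), of "Suc i"] this(2) show "P i (2 * i + 1)" by simp
  next
    fix i assume "\<forall>i<n. P i (2 * i + 1)" and i: "i \<in> {1..n}"
    then have "P (i - 1) (2 * (i - 1) + 1)" by auto
    moreover have "2 * (i - 1) + 1 = 2 * i - 1" using i by auto
    ultimately show "P (i - 1) (2 * i - 1)" by simp
  qed
  from this[of "length fs" "\<lambda>i m. (fs ! i) (take m \<rho>) = Some (\<rho> ! m)"]
  show ?thesis by (simp add: angle_def)
qed

text \<open>The conditions for \<open>fs\<close> read only entries of \<rho>, so the pair
  \<open>b\<close>, \<open>a\<close> adds just the condition for \<open>f\<close>. This is how a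
  parameter list grows when the dot passes one symbol.\<close>

lemma angle_snoc:
  assumes "length \<rho> = 2 * length fs"
  shows "\<rho> @ [b, a] \<in> angle \<Phi> (fs @ [f]) \<longleftrightarrow>
    \<rho> \<in> angle \<Phi> fs \<and> b \<in> \<Phi> \<and> a \<in> \<Phi> \<and> f (\<rho> @ [b]) = Some a"
  using assms by (auto simp: angle_iff nth_append less_Suc_eq)

text \<open>The PELLA steps only ask that a function be defined at a list. The domain and range
  required by \<open>is_pfun\<close> then put all parameters into \<open>Phi G\<close>.\<close>

lemma wf_pfuns:
  assumes "wf_prule G r" "d \<le> arity r" "(pfuns r ! d) xs = Some a"
  shows "set xs \<subseteq> Phi G" "length xs = 2 * d + 1" "a \<in> Phi G"
proof -
  have "is_pfun (Phi G) (2 * d + 1) (pfuns r ! d)"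
    using assms(1,2) unfolding wf_prule_def by (auto dest: bspec[of _ _ "Suc d"])
  then show "set xs \<subseteq> Phi G" "length xs = 2 * d + 1" "a \<in> Phi G"
    using assms(3) by (auto simp: is_pfun_def ran_def)
qed

text \<open>The rules of the items in \<open>item_bar G (r, d, i, j, \<rho>)\<close>, which do not depend on \<open>i\<close>
  and \<open>j\<close>.\<close>

definition item_rules :: "('s, 'p, 'c) pll \<Rightarrow> ('s, 'p) prule \<Rightarrow> nat \<Rightarrow> 'p list \<Rightarrow> ('s, 'p) irule set" where
  "item_rules G r d \<rho> =
     {rule_i r \<sigma> | \<sigma>. params_i G r \<sigma> \<and> take (2 * (d + 1)) \<sigma> = \<rho>} \<union>
     {rule_ii r h \<tau> b \<beta> | h \<tau> b \<beta>.
        params_ii G r h \<tau> b \<beta> \<and> d \<le> h - 1 \<and> take (2 * (d + 1)) \<tau> = \<rho>}"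

lemma items_bar_iff:
  "(q, d, i, j) \<in> items_bar G I \<longleftrightarrow> (\<exists>r \<rho>. (r, d, i, j, \<rho>) \<in> I \<and> q \<in> item_rules G r d \<rho>)"
proof -
  have "(q, d, i, j) \<in> item_bar G (r, d', i', j', \<rho>) \<longleftrightarrow>
    d = d' \<and> i = i' \<and> j = j' \<and> q \<in> item_rules G r d \<rho>" for r d' i' j' \<rho>
    by (simp add: item_rules_def) blast
  then show ?thesis by (force simp: items_bar_def simp del: item_bar.simps)
qed

text \<open>In a rule of type (ii) \<open>h\<close> is positive, so the truncated
  \<open>d \<le> h - 1\<close> amounts to \<open>d < h\<close>.\<close>

lemma item_rulesE:
  assumes "q \<in> item_rules G r d \<rho>"
  obtains \<sigma> where "q = rule_i r \<sigma>" "params_i G r \<sigma>" "take (2 * d + 2) \<sigma> = \<rho>"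
  | h \<tau> b \<beta> where "q = rule_ii r h \<tau> b \<beta>" "params_ii G r h \<tau> b \<beta>" "d < h"
      "take (2 * d + 2) \<tau> = \<rho>"
proof -
  have "d < h" if "params_ii G r h \<tau> b \<beta>" "d \<le> h - 1" for h \<tau> b \<beta>
    using that by (auto simp: params_ii_def)
  then show thesis using assms that unfolding item_rules_def by auto
qed

lemma item_rules_typeI:
  "params_i G r \<sigma> \<Longrightarrow> take (2 * d + 2) \<sigma> = \<rho> \<Longrightarrow> rule_i r \<sigma> \<in> item_rules G r d \<rho>"
  by (auto simp: item_rules_def)

lemma item_rules_typeII:
  "params_ii G r h \<tau> b \<beta> \<Longrightarrow> d < h \<Longrightarrow> take (2 * d + 2) \<tau> = \<rho> \<Longrightarrow>
    rule_ii r h \<tau> b \<beta> \<in> item_rules G r d \<rho>"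
  unfolding item_rules_def by (rule UnI2) fastforce

lemma params_iD:
  assumes "params_i G r \<sigma>"
  shows "set \<sigma> \<subseteq> Phi G" "length \<sigma> = 2 * arity r + 2"
    "d \<le> arity r \<Longrightarrow> (pfuns r ! d) (take (2 * d + 1) \<sigma>) = Some (\<sigma> ! (2 * d + 1))"
  using assms by (auto simp: params_i_def angle_iff)

lemma params_iiD:
  assumes "params_ii G r h \<tau> b \<beta>"
  shows "set \<tau> \<subseteq> Phi G" "length \<tau> = 2 * h" "0 < h" "h \<le> arity r" "b \<in> Phi G" "\<beta> \<in> Phi G"
    "d < h \<Longrightarrow> (pfuns r ! d) (take (2 * d + 1) \<tau>) = Some (\<tau> ! (2 * d + 1))"
  using assms by (auto simp: params_ii_def angle_iff)

lemma rule_i_simps [simp]: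
  "fst (rule_i r \<sigma>) = Sym (lhs r) (hd \<sigma>) (last \<sigma>)"
  "snd (rule_i r \<sigma>) = decorate (syms r) \<sigma>"
  by (simp_all add: rule_i_def)

lemma rule_ii_simps [simp]:
  "fst (rule_ii r h \<tau> b \<beta>) = Sym (lhs r) (hd \<tau>) \<beta>"
  "snd (rule_ii r h \<tau> b \<beta>) = decorate (take h (syms r)) (\<tau> @ [b]) @ [Bot]"
  by (simp_all add: rule_ii_def)

text \<open>Both kinds of parameter list have at least two entries, since \<sigma> has length
  \<open>2 * arity r + 2\<close> and \<tau> has length \<open>2 * h\<close> with \<open>h\<close>
  positive. These two entries are the parameters of a freshly predicted item.\<close>

lemma rule_barE:
  assumes "q \<in> rule_bar G r"
  obtains \<alpha> \<beta> a where "fst q = Sym (lhs r) \<alpha> \<beta>" "(pfuns r ! 0) [\<alpha>] = Some a"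
    "q \<in> item_rules G r 0 [\<alpha>, a]"
proof -
  from assms consider \<sigma> where "q = rule_i r \<sigma>" "params_i G r \<sigma>"
    | h \<tau> b \<beta> where "q = rule_ii r h \<tau> b \<beta>" "params_ii G r h \<tau> b \<beta>"
    by (auto simp: rule_bar_def)
  then show thesis
  proof cases
    case 1
    then obtain \<alpha> a zs where "\<sigma> = \<alpha> # a # zs"
      using params_iD(2)[OF 1(2)] by (cases \<sigma>; cases "tl \<sigma>") auto
    then show thesis
      using 1 params_iD(3)[OF 1(2), of 0] item_rules_typeI[OF 1(2), of 0] by (intro that) auto
  next
    case 2
    then obtain \<alpha> a zs where "\<tau> = \<alpha> # a # zs"
      using params_iiD(2,3)[OF 2(2)] by (cases \<tau>; cases "tl \<tau>") auto
    then show thesis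
      using 2 params_iiD(3)[OF 2(2)] params_iiD(7)[OF 2(2), of 0] item_rules_typeII[OF 2(2), of 0]
      by (intro that) auto
  qed
qed

section \<open>Left sides and dot positions of the rules induced by an item\<close>

lemma item_rules_Rules_bar:
  assumes "q \<in> item_rules G r d \<rho>" "r \<in> Rules G"
  shows "q \<in> Rules_bar G"
proof -
  have "q \<in> rule_bar G r" using assms(1) unfolding item_rules_def rule_bar_def by blast
  then show ?thesis using assms(2) by (auto simp: Rules_bar_def)
qed

lemma item_rules_fst:
  assumes "q \<in> item_rules G r d \<rho>"
  shows "\<exists>\<beta>\<in>Phi G. fst q = Sym (lhs r) (hd \<rho>) \<beta>"
  using assms
proof (cases rule: item_rulesE)
  case (1 \<sigma>)
  then have "\<sigma> \<noteq> []" "last \<sigma> \<in> Phi G"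
    using params_iD(1,2)[OF 1(2)] last_in_set[of \<sigma>] by fastforce+
  then show ?thesis using 1 by auto
next
  case (2 h \<tau> b \<beta>)
  then have "\<tau> \<noteq> []" "\<beta> \<in> Phi G"
    using params_iiD[OF 2(2)] by auto
  then show ?thesis using 2 by auto
qed

text \<open>Type (i) contains no \<open>Bot\<close>. In type (ii) the right side has
  \<open>h + 1\<close> symbols and \<open>d < h\<close>, so at least two symbols remain behind the
  dot.\<close>

lemma item_rules_rest:
  assumes "q \<in> item_rules G r d \<rho>"
  shows "drop d (snd q) \<noteq> [Bot]"
  using assms
proof (cases rule: item_rulesE)
  case (1 \<sigma>)
  have "Bot \<notin> set (drop d (decorate (syms r) \<sigma>))"
    using Sym_in_set_decorate in_set_dropD by fastforce
  then show ?thesis using 1 by auto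
next
  case (2 h \<tau> b \<beta>)
  then have "length (drop d (snd q)) \<noteq> length [Bot]"
    using params_iiD(4)[OF 2(2)] by auto
  then show ?thesis by metis
qed

lemma item_rules_le_length:
  assumes "q \<in> item_rules G r d \<rho>" "d \<le> arity r"
  shows "d \<le> length (snd q)"
  using assms(1)
proof (cases rule: item_rulesE)
  case (2 h \<tau> b \<beta>)
  then show ?thesis using params_iiD(4)[OF 2(2)] by auto
qed (use assms(2) in auto)

text \<open>Type (ii) is impossible here because its right side is longer than \<open>d\<close>. In
  type (i) the prefix \<rho> is all of \<sigma>, so it determines both parameters of the left
  side.\<close>

lemma item_rules_full:
  assumes "q \<in> item_rules G r d \<rho>" "d = length (snd q)"
  shows "d = arity r" "fst q = Sym (lhs r) (\<rho> ! 0) (\<rho> ! (2 * d + 1))"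
proof -
  from assms(1) have "d = arity r \<and> fst q = Sym (lhs r) (\<rho> ! 0) (\<rho> ! (2 * d + 1))"
  proof (cases rule: item_rulesE)
    case (1 \<sigma>)
    then show ?thesis using assms(2) params_iD(2)[OF 1(2)]
      by (cases "\<sigma> = []") (auto simp: hd_conv_nth last_conv_nth)
  next
    case (2 h \<tau> b \<beta>)
    then show ?thesis using assms(2) params_iiD(4)[OF 2(2)] by auto
  qed
  then show "d = arity r" "fst q = Sym (lhs r) (\<rho> ! 0) (\<rho> ! (2 * d + 1))" by auto
qed

section \<open>Moving the dot over one symbol\<close>

lemma take_snoc2D:
  assumes "take (n + 2) \<sigma> = \<rho> @ [b, a]" "length \<rho> = n"
  shows "take n \<sigma> = \<rho>" "i < n \<Longrightarrow> \<sigma> ! i = \<rho> ! i" "\<sigma> ! n = b" "n + 2 \<le> length \<sigma>"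
proof -
  have "length (take (n + 2) \<sigma>) = n + 2" using assms by simp
  then show len: "n + 2 \<le> length \<sigma>" by simp
  have "take n (take (n + 2) \<sigma>) = \<rho>" using assms by simp
  then show "take n \<sigma> = \<rho>" by (simp add: min_def)
  have nth: "\<sigma> ! i = (\<rho> @ [b, a]) ! i" if "i < n + 2" for i
    using assms(1) that by (metis nth_take)
  show "i < n \<Longrightarrow> \<sigma> ! i = \<rho> ! i" "\<sigma> ! n = b"
    using nth[of i] nth[of n] assms(2) by (auto simp: nth_append)
qed

text \<open>Moving the dot back: the same \<sigma> or \<tau> witnesses the shorter prefix, and its
  entry behind \<rho> is the lower parameter of the symbol passed.\<close>

lemma item_rules_SucD:
  assumes q: "q \<in> item_rules G r (Suc d) (\<rho> @ [b, a])" and len: "length \<rho> = 2 * d + 2"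
  shows "q \<in> item_rules G r d \<rho>" "d < length (snd q)"
    "snd q ! d = Sym (syms r ! d) (\<rho> ! (2 * d + 1)) b"
proof -
  from q have "q \<in> item_rules G r d \<rho> \<and> d < length (snd q) \<and>
    snd q ! d = Sym (syms r ! d) (\<rho> ! (2 * d + 1)) b"
  proof (cases rule: item_rulesE)
    case (1 \<sigma>)
    then have "take (2 * d + 2 + 2) \<sigma> = \<rho> @ [b, a]" by simp
    note * = take_snoc2D[OF this len]
    have "d < arity r" using *(4) params_iD(2)[OF 1(2)] by simp
    then show ?thesis
      using 1 *(1,3) *(2)[of "2 * d + 1"] item_rules_typeI[OF 1(2) *(1)] by (simp add: nth_decorate)
  next
    case (2 h \<tau> c \<beta>)
    then have "take (2 * d + 2 + 2) \<tau> = \<rho> @ [b, a]" by simp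
    note * = take_snoc2D[OF this len]
    have "d < length (take h (syms r))" using 2(3) params_iiD(4)[OF 2(2)] by simp
    then show ?thesis
      using 2 *(1,3,4) *(2)[of "2 * d + 1"] item_rules_typeII[OF 2(2) _ *(1)]
      by (simp add: nth_decorate nth_append)
  qed
  then show "q \<in> item_rules G r d \<rho>" "d < length (snd q)"
    "snd q ! d = Sym (syms r ! d) (\<rho> ! (2 * d + 1)) b" by auto
qed

lemma take_add2:
  "n + 2 \<le> length \<sigma> \<Longrightarrow> take (n + 2) \<sigma> = take n \<sigma> @ [\<sigma> ! n, \<sigma> ! (n + 1)]"
  "n + 2 \<le> length \<sigma> \<Longrightarrow> take (n + 1) \<sigma> = take n \<sigma> @ [\<sigma> ! n]"
  by (simp_all add: take_Suc_conv_app_nth)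

text \<open>Moving the dot forward. The parameter list of the rule supplies the next function value,
  except when the dot passes symbol \<open>h\<close> of a rule of type (ii). In that case exactly
  \<open>[Bot]\<close> remains, which the premise of the last claim excludes.\<close>

lemma item_rules_nextD:
  assumes q: "q \<in> item_rules G r d \<rho>" and d: "d < length (snd q)"
    and X: "snd q ! d = Sym X \<alpha> \<beta>"
  shows "d < arity r" "syms r ! d = X" "\<rho> ! (2 * d + 1) = \<alpha>"
    and "drop (Suc d) (snd q) \<noteq> [Bot] \<Longrightarrow>
      \<exists>a. (pfuns r ! Suc d) (\<rho> @ [\<beta>]) = Some a \<and> q \<in> item_rules G r (Suc d) (\<rho> @ [\<beta>, a])"
proof -
  from q have "d < arity r \<and> syms r ! d = X \<and> \<rho> ! (2 * d + 1) = \<alpha> \<and>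
    (drop (Suc d) (snd q) \<noteq> [Bot] \<longrightarrow>
      (\<exists>a. (pfuns r ! Suc d) (\<rho> @ [\<beta>]) = Some a \<and> q \<in> item_rules G r (Suc d) (\<rho> @ [\<beta>, a])))"
  proof (cases rule: item_rulesE)
    case (1 \<sigma>)
    have *: "d < arity r" using 1 d by simp
    then have X': "Sym X \<alpha> \<beta> = Sym (syms r ! d) (\<sigma> ! (2 * d + 1)) (\<sigma> ! (2 * d + 2))"
      using X 1 by (simp add: nth_decorate)
    have len: "2 * d + 2 + 2 \<le> length \<sigma>" using * params_iD(2)[OF 1(2)] by simp
    note t = take_add2[OF len]
    have "(pfuns r ! Suc d) (\<rho> @ [\<beta>]) = Some (\<sigma> ! (2 * d + 3))"
      using params_iD(3)[OF 1(2), of "Suc d"] * t(2) X' 1(3) by (simp add: numeral_eq_Suc)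
    moreover have "q \<in> item_rules G r (Suc d) (\<rho> @ [\<beta>, \<sigma> ! (2 * d + 3)])"
      using item_rules_typeI[OF 1(2), of "Suc d"] t(1) X' 1 by (simp add: numeral_eq_Suc)
    ultimately show ?thesis using * X' 1(3) by auto
  next
    case (2 h \<tau> b \<gamma>)
    have h: "h \<le> arity r" and len\<tau>: "length \<tau> = 2 * h" using params_iiD[OF 2(2)] by auto
    \<comment> \<open>For \<open>d = h - 1\<close> the entry at \<open>2 * d + 2\<close> is the
      appended \<open>b\<close>; otherwise it belongs to \<tau>.\<close>
    have X': "Sym X \<alpha> \<beta> = Sym (syms r ! d) (\<tau> ! (2 * d + 1)) ((\<tau> @ [b]) ! (2 * d + 2))"
      using X 2 h len\<tau> by (simp add: nth_decorate nth_append)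
    have "\<exists>a. (pfuns r ! Suc d) (\<rho> @ [\<beta>]) = Some a \<and> q \<in> item_rules G r (Suc d) (\<rho> @ [\<beta>, a])"
      if rest: "drop (Suc d) (snd q) \<noteq> [Bot]"
    proof -
      have "Suc d \<noteq> h" using rest 2 h by auto
      with 2(3) have dh: "Suc d < h" by simp
      then have len: "2 * d + 2 + 2 \<le> length \<tau>" using len\<tau> by simp
      note t = take_add2[OF len]
      have b: "\<beta> = \<tau> ! (2 * d + 2)" using X' len by (simp add: nth_append)
      have "(pfuns r ! Suc d) (\<rho> @ [\<beta>]) = Some (\<tau> ! (2 * d + 3))"
        using params_iiD(7)[OF 2(2) dh] t(2) b 2(4) by (simp add: numeral_eq_Suc)
      moreover have "q \<in> item_rules G r (Suc d) (\<rho> @ [\<beta>, \<tau> ! (2 * d + 3)])"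
        using item_rules_typeII[OF 2(2) dh] t(1) b 2 by (simp add: numeral_eq_Suc)
      ultimately show ?thesis by blast
    qed
    then show ?thesis using 2(3,4) h X' by auto
  qed
  then show "d < arity r" "syms r ! d = X" "\<rho> ! (2 * d + 1) = \<alpha>"
    "drop (Suc d) (snd q) \<noteq> [Bot] \<Longrightarrow>
      \<exists>a. (pfuns r ! Suc d) (\<rho> @ [\<beta>]) = Some a \<and> q \<in> item_rules G r (Suc d) (\<rho> @ [\<beta>, a])"
    by auto
qed

subsection \<open>Invariants\<close>

fun wf_pitem :: "('s, 'p, 'c) pll \<Rightarrow> ('s, 'p) pitem \<Rightarrow> bool" where
  "wf_pitem G (r, d, i, j, \<rho>) \<longleftrightarrow>
     r \<in> Rules G \<and> d \<le> arity r \<and> \<rho> \<in> angle (Phi G) (take (Suc d) (pfuns r))"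

text \<open>Items with left side \<open>Top\<close> have no counterpart in PELLA. The second condition ensures that
  they only take part in the predictions at position 0, where they predict the items of \<open>PInit G\<close>.\<close>

fun wf_item :: "('s, 'p, 'c) pll \<Rightarrow> ('s, 'p) item \<Rightarrow> bool" where
  "wf_item G (q, d, i, j) \<longleftrightarrow>
     q \<in> Rules_bar G \<and> (fst q = Top \<longrightarrow> d = 0 \<longrightarrow> j = 0)"

lemma wf_pitem_0I:
  assumes "r \<in> Rules G" "wf_prule G r" "(pfuns r ! 0) [\<alpha>] = Some a"
  shows "wf_pitem G (r, 0, i, j, [\<alpha>, a])"
  using assms(1,3) wf_pfuns[OF assms(2) _ assms(3)] by (simp add: angle_iff take_Suc_conv_app_nth)

lemma wf_pitem_SucI:
  assumes "wf_pitem G (r, d, i, j, \<rho>)" "wf_prule G r" "d < arity r"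
    "(pfuns r ! Suc d) (\<rho> @ [b]) = Some a"
  shows "wf_pitem G (r, Suc d, i', j', \<rho> @ [b, a])"
proof -
  let ?fs = "take (Suc d) (pfuns r)"
  have \<rho>: "\<rho> \<in> angle (Phi G) ?fs" using assms(1) by simp
  then have "length \<rho> = 2 * length ?fs" by (simp add: angle_iff)
  moreover have "b \<in> Phi G" "a \<in> Phi G"
    using wf_pfuns[OF assms(2) _ assms(4)] assms(3) by auto
  moreover have "take (Suc (Suc d)) (pfuns r) = ?fs @ [pfuns r ! Suc d]"
    using assms(3) by (simp add: take_Suc_conv_app_nth)
  ultimately show ?thesis
    using assms \<rho> by (simp add: angle_snoc)
qed

section \<open>Induced rules with a prescribed next symbol\<close>

lemma wf_pitem_length: "wf_pitem G (r, d, i, j, \<rho>) \<Longrightarrow> length \<rho> = 2 * d + 2"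
  by (auto simp: angle_iff)

text \<open>With the dot at the end, \<rho> is a complete parameter list of type (i). This yields
  the completed ELLA item that corresponds to a completed PELLA item.\<close>

lemma wf_pitem_full:
  assumes "wf_pitem G (r, arity r, i, j, \<rho>)"
  shows "rule_i r \<rho> \<in> item_rules G r (arity r) \<rho>"
    "rule_i r \<rho> = (Sym (lhs r) (\<rho> ! 0) (\<rho> ! (2 * arity r + 1)), decorate (syms r) \<rho>)"
proof -
  have len: "length \<rho> = 2 * arity r + 2" using wf_pitem_length[OF assms] .
  have "params_i G r \<rho>" using assms by (simp add: params_i_def)
  then show "rule_i r \<rho> \<in> item_rules G r (arity r) \<rho>"
    using len by (intro item_rules_typeI) auto
  have "\<rho> \<noteq> []" using len by auto
  then show "rule_i r \<rho> = (Sym (lhs r) (\<rho> ! 0) (\<rho> ! (2 * arity r + 1)), decorate (syms r) \<rho>)"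
    using len by (simp add: rule_i_def hd_conv_nth last_conv_nth)
qed

text \<open>The undefined function is the one that a rule of type (ii) with \<open>h = Suc d\<close>
  requires. The last argument of \<open>rule_ii\<close> may be any element of \<open>Phi G\<close>;
  \<open>b\<close> is reused for it.\<close>

lemma item_rules_stuck:
  assumes "wf_pitem G (r, d, i, j, \<rho>)" "d < arity r" "b \<in> Phi G"
    "(pfuns r ! Suc d) (\<rho> @ [b]) = None"
  shows "rule_ii r (Suc d) \<rho> b b \<in> item_rules G r d \<rho>"
    "snd (rule_ii r (Suc d) \<rho> b b) ! d = Sym (syms r ! d) (\<rho> ! (2 * d + 1)) b"
proof -
  have len: "length \<rho> = 2 * d + 2" using wf_pitem_length[OF assms(1)] .
  have "params_ii G r (Suc d) \<rho> b b" using assms by (simp add: params_ii_def)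
  then show "rule_ii r (Suc d) \<rho> b b \<in> item_rules G r d \<rho>"
    using len by (intro item_rules_typeII) auto
  show "snd (rule_ii r (Suc d) \<rho> b b) ! d = Sym (syms r ! d) (\<rho> ! (2 * d + 1)) b"
    using len assms(2) by (simp add: nth_append nth_decorate)
qed

text \<open>Downward induction from \<open>d = arity r\<close>, where type (i) applies. Below that,
  \<phi> is tried as the next lower parameter: either the next function is undefined and type (ii)
  applies, or the longer list has a rule, which also fits the shorter one.\<close>

lemma item_rules_nonempty:
  assumes "d \<le> arity r" "wf_prule G r" "\<phi> \<in> Phi G" "wf_pitem G (r, d, i, j, \<rho>)"
  shows "item_rules G r d \<rho> \<noteq> {}"
  using assms(1,4)
proof (induction d arbitrary: \<rho> rule: inc_induct)
  case base
  then show ?case using wf_pitem_full(1) by fastforce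
next
  case (step d)
  show ?case
  proof (cases "(pfuns r ! Suc d) (\<rho> @ [\<phi>])")
    case None
    then show ?thesis using item_rules_stuck(1)[OF step.prems _ assms(3)] step.hyps by auto
  next
    case (Some a)
    then have "item_rules G r (Suc d) (\<rho> @ [\<phi>, a]) \<noteq> {}"
      using step wf_pitem_SucI[OF step.prems assms(2)] by blast
    then show ?thesis using item_rules_SucD(1)[OF _ wf_pitem_length[OF step.prems]] by fastforce
  qed
qed

lemma item_rules_next:
  assumes "wf_prule G r" "wf_pitem G (r, d, i, j, \<rho>)" "d < arity r" "b \<in> Phi G"
  obtains q where "q \<in> item_rules G r d \<rho>" "d < length (snd q)"
    "snd q ! d = Sym (syms r ! d) (\<rho> ! (2 * d + 1)) b"
proof (cases "(pfuns r ! Suc d) (\<rho> @ [b])")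
  case None
  have "d < length (snd (rule_ii r (Suc d) \<rho> b b))" using assms(3) by simp
  then show thesis using that item_rules_stuck[OF assms(2-4) None] by blast
next
  case (Some a)
  have "wf_pitem G (r, Suc d, i, j, \<rho> @ [b, a])" using wf_pitem_SucI[OF assms(2,1,3) Some] .
  \<comment> \<open>Here \<open>b\<close> also serves as the parameter \<phi> for the remaining
    symbols.\<close>
  then obtain q where "q \<in> item_rules G r (Suc d) (\<rho> @ [b, a])"
    using item_rules_nonempty[OF _ assms(1,4)] assms(3) by (metis Suc_leI all_not_in_conv)
  then show thesis using that item_rules_SucD[OF _ wf_pitem_length[OF assms(2)]] by blast
qed

section \<open>The symbols \<open>Top\<close> and \<open>Bot\<close> in induced rules\<close>

lemma Rules_bar_Top: "(Top, w) \<in> Rules_bar G \<longleftrightarrow> (\<exists>\<beta>\<in>Phi G. w = [Sym (Start G) (phi_start G) \<beta>])"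
  by (auto simp: Rules_bar_def rule_bar_def rule_i_def rule_ii_def)

text \<open>Used to see that completion never moves the dot over \<open>Bot\<close>.\<close>

lemma Rules_bar_lhs_Bot: "(Bot, w) \<notin> Rules_bar G"
  by (auto simp: Rules_bar_def rule_bar_def rule_i_def rule_ii_def)

lemma Rules_bar_cases:
  assumes "(L, w) \<in> Rules_bar G"
  obtains "L = Top" | r where "r \<in> Rules G" "(L, w) \<in> rule_bar G r"
  using assms unfolding Rules_bar_def by blast

text \<open>Used to see that items with left side \<open>Top\<close> are neither predicted nor used
  to advance another item.\<close>

lemma Rules_bar_rhs_Top:
  assumes "(L, w) \<in> Rules_bar G" "d < length w"
  shows "w ! d \<noteq> Top"
proof -
  have "Top \<notin> set w"
    using assms(1)
    by (fastforce simp: Rules_bar_def rule_bar_def rule_i_def rule_ii_def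
        dest: Sym_in_set_decorate)
  then show ?thesis using assms(2) nth_mem by metis
qed

subsection \<open>The steps of ELLA in terms of dot positions\<close>

lemma split_at:
  assumes "d < length v"
  obtains a b where "v = a @ [v ! d] @ b" "length a = d"
  using that[of "take d v" "drop (Suc d) v"] id_take_nth_drop[OF assms] assms by simp

lemma Norm_iff:
  "(q, d, i, j) \<in> Norm I' \<longleftrightarrow>
    (q, d, i, j) \<in> I' \<and> fst q \<noteq> Top \<and> d \<le> length (snd q) \<and> drop d (snd q) \<noteq> [Bot]"
    (is "?L \<longleftrightarrow> ?R")
proof
  show ?R if ?L using that by (auto simp: Norm_def)
next
  assume ?R
  moreover obtain L w where "q = (L, w)" by (cases q)
  moreover have "w = take d w @ drop d w" by simp
  moreover have "length (take d w) = d" if "d \<le> length w" using that by simp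
  ultimately show ?L unfolding Norm_def mem_Collect_eq by (metis fst_conv snd_conv)
qed

lemma EPredict_iff:
  "(q, d, i, j) \<in> EPredict G k I' \<longleftrightarrow> (q, d, i, j) \<in> I' \<or>
    d = 0 \<and> i = k \<and> j = k \<and> q \<in> Rules_bar G \<and>
    (\<exists>L v e m. ((L, v), e, m, k) \<in> I' \<and> e < length v \<and> v ! e = fst q)"
    (is "_ \<longleftrightarrow> ?old \<or> ?new")
proof
  assume "(q, d, i, j) \<in> EPredict G k I'"
  then consider ?old | L a M b m w where "q = (M, w)" "d = 0" "i = k" "j = k"
    "((L, a @ [M] @ b), length a, m, k) \<in> I'" "(M, w) \<in> Rules_bar G"
    unfolding EPredict_def by blast
  then show "?old \<or> ?new"
  proof cases
    case 2
    have "length a < length (a @ [M] @ b)" "(a @ [M] @ b) ! length a = M" by simp_all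
    then have "\<exists>L v e m. ((L, v), e, m, k) \<in> I' \<and> e < length v \<and> v ! e = M"
      using 2(5) by blast
    then show ?thesis using 2 by simp
  qed simp
next
  assume "?old \<or> ?new"
  then show "(q, d, i, j) \<in> EPredict G k I'"
  proof
    assume ?new
    then obtain L v e m where x: "((L, v), e, m, k) \<in> I'" "e < length v" "v ! e = fst q" by blast
    obtain a b where "v = a @ [fst q] @ b" "length a = e" using split_at[OF x(2)] x(3) by metis
    with x(1) \<open>?new\<close> show ?thesis unfolding EPredict_def by (cases q) auto
  qed (simp add: EPredict_def)
qed

lemma EComplete_iff:
  "(q, d, i, j) \<in> EComplete k I' \<longleftrightarrow> (q, d, i, j) \<in> I' \<or>
    (\<exists>e m w. d = Suc e \<and> j = k \<and> (q, e, i, m) \<in> I' \<and> e < length (snd q) \<and>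
      ((snd q ! e, w), length w, m, k) \<in> I')"
    (is "_ \<longleftrightarrow> ?old \<or> ?new")
proof
  assume "(q, d, i, j) \<in> EComplete k I'"
  then show "?old \<or> ?new" by (fastforce simp: EComplete_def)
next
  assume "?old \<or> ?new"
  then show "(q, d, i, j) \<in> EComplete k I'"
  proof
    assume ?new
    then obtain e m w where x: "d = Suc e" "j = k" "(q, e, i, m) \<in> I'" "e < length (snd q)"
      "((snd q ! e, w), length w, m, k) \<in> I'" by blast
    obtain a b where "snd q = a @ [snd q ! e] @ b" "length a = e" using split_at[OF x(4)] .
    then obtain L M where "q = (L, a @ [M] @ b)" "snd q ! e = M" by (metis prod.collapse)
    with x \<open>length a = e\<close> show ?thesis unfolding EComplete_def by auto
  qed (simp add: EComplete_def)
qed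

lemma EScan_iff:
  "(q, d, i, j) \<in> EScan T' k I' \<longleftrightarrow> (q, d, i, j) \<in> I' \<or>
    (\<exists>e c. d = Suc e \<and> j = k + length c \<and> (q, e, i, k) \<in> I' \<and> e < length (snd q) \<and>
      (snd q ! e, c) \<in> T')"
    (is "_ \<longleftrightarrow> ?old \<or> ?new")
proof
  assume "(q, d, i, j) \<in> EScan T' k I'"
  then show "?old \<or> ?new" by (fastforce simp: EScan_def)
next
  assume "?old \<or> ?new"
  then show "(q, d, i, j) \<in> EScan T' k I'"
  proof
    assume ?new
    then obtain e c where x: "d = Suc e" "j = k + length c" "(q, e, i, k) \<in> I'"
      "e < length (snd q)" "(snd q ! e, c) \<in> T'" by blast
    obtain a b where "snd q = a @ [snd q ! e] @ b" "length a = e" using split_at[OF x(4)] .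
    then obtain L M where "q = (L, a @ [M] @ b)" "snd q ! e = M" by (metis prod.collapse)
    with x \<open>length a = e\<close> show ?thesis unfolding EScan_def by auto
  qed (simp add: EScan_def)
qed

lemma ETokens_eq:
  "ETokens G D T' k I' = Sel_bar G T'
     {x. \<exists>q d i. (q, d, i, k) \<in> I' \<and> d < length (snd q) \<and> snd q ! d \<in> Terms_bar G \<and>
           x \<in> Lex_bar G (snd q ! d) D k}"
proof -
  have "(\<exists>L a t b i. ((L, a @ [t] @ b), length a, i, k) \<in> I' \<and> t \<in> Terms_bar G \<and>
      x \<in> Lex_bar G t D k) \<longleftrightarrow>
    (\<exists>q d i. (q, d, i, k) \<in> I' \<and> d < length (snd q) \<and> snd q ! d \<in> Terms_bar G \<and>
      x \<in> Lex_bar G (snd q ! d) D k)" for x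
  proof
    assume "\<exists>L a t b i. ((L, a @ [t] @ b), length a, i, k) \<in> I' \<and> t \<in> Terms_bar G \<and>
      x \<in> Lex_bar G t D k"
    then show "\<exists>q d i. (q, d, i, k) \<in> I' \<and> d < length (snd q) \<and> snd q ! d \<in> Terms_bar G \<and>
      x \<in> Lex_bar G (snd q ! d) D k" by fastforce
  next
    assume "\<exists>q d i. (q, d, i, k) \<in> I' \<and> d < length (snd q) \<and> snd q ! d \<in> Terms_bar G \<and>
      x \<in> Lex_bar G (snd q ! d) D k"
    then obtain q d i where q: "(q, d, i, k) \<in> I'" "d < length (snd q)"
      "snd q ! d \<in> Terms_bar G" "x \<in> Lex_bar G (snd q ! d) D k" by blast
    then show "\<exists>L a t b i. ((L, a @ [t] @ b), length a, i, k) \<in> I' \<and> t \<in> Terms_bar G \<and>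
      x \<in> Lex_bar G t D k"
      using split_at[OF q(2)] by (metis prod.collapse)
  qed
  then show ?thesis by (simp only: ETokens_def)
qed

subsection \<open>The two inclusions\<close>

text \<open>Well-formedness is carried along because \<open>item_rules_next\<close> and
  \<open>wf_pitem_full\<close> start from items satisfying \<open>wf_pitem\<close>.\<close>

definition covers :: "('s, 'p, 'c) pll \<Rightarrow> ('s, 'p) pitem set \<Rightarrow> ('s, 'p) item set \<Rightarrow> bool" where
  "covers G I I' \<longleftrightarrow> (\<forall>x\<in>I. wf_pitem G x) \<and> items_bar G I \<subseteq> Norm I'"

text \<open>Induced items of well-formed parameterized items meet the side conditions of
  \<open>Norm\<close> automatically, so only membership in \<open>I'\<close> remains to be
  shown.\<close>

lemma coversI:
  assumes "\<And>r d i j \<rho>. (r, d, i, j, \<rho>) \<in> I \<Longrightarrow> wf_pitem G (r, d, i, j, \<rho>)"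
    and "\<And>r d i j \<rho> q. (r, d, i, j, \<rho>) \<in> I \<Longrightarrow> q \<in> item_rules G r d \<rho> \<Longrightarrow> (q, d, i, j) \<in> I'"
  shows "covers G I I'"
  unfolding covers_def
proof (intro conjI ballI subrelI subsetI)
  fix x assume "x \<in> I"
  then show "wf_pitem G x" using assms(1) by (cases x) blast
next
  fix y assume y: "y \<in> items_bar G I"
  obtain q d i j where [simp]: "y = (q, d, i, j)" by (cases y)
  from y obtain r \<rho> where x: "(r, d, i, j, \<rho>) \<in> I" "q \<in> item_rules G r d \<rho>"
    by (auto simp: items_bar_iff)
  then have "d \<le> arity r" using assms(1) by fastforce
  then show "y \<in> Norm I'"
    using x assms(2) item_rules_fst[OF x(2)] item_rules_rest[OF x(2)] item_rules_le_length[OF x(2)]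
    by (auto simp: Norm_iff)
qed

lemma coversD:
  assumes "covers G I I'" "(r, d, i, j, \<rho>) \<in> I"
  shows "wf_pitem G (r, d, i, j, \<rho>)" "q \<in> item_rules G r d \<rho> \<Longrightarrow> (q, d, i, j) \<in> I'"
proof -
  show "wf_pitem G (r, d, i, j, \<rho>)" using assms unfolding covers_def by blast
  assume "q \<in> item_rules G r d \<rho>"
  then have "(q, d, i, j) \<in> Norm I'" using assms items_bar_iff unfolding covers_def by blast
  then show "(q, d, i, j) \<in> I'" by (simp add: Norm_iff)
qed

lemma covers_UN:
  assumes "\<And>n. covers G (A n) (B n)"
  shows "covers G (\<Union>n. A n) (\<Union>n. B n)"
proof (rule coversI)
  fix r d i j \<rho> assume "(r, d, i, j, \<rho>) \<in> (\<Union>n. A n)"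
  then obtain n where n: "(r, d, i, j, \<rho>) \<in> A n" by blast
  show "wf_pitem G (r, d, i, j, \<rho>)" using coversD(1)[OF assms n] .
  fix q assume "q \<in> item_rules G r d \<rho>"
  from coversD(2)[OF assms n this] show "(q, d, i, j) \<in> (\<Union>n. B n)" by blast
qed

lemma covers_mono: "covers G I I' \<Longrightarrow> I' \<subseteq> J' \<Longrightarrow> covers G I J'"
  unfolding covers_def Norm_def by blast

text \<open>The condition on \<open>PInit G\<close> supplies the counterparts of items predicted
  from \<open>Top\<close> items, which themselves have no counterpart.\<close>

definition covered :: "('s, 'p, 'c) pll \<Rightarrow> ('s, 'p) pitem set \<Rightarrow> ('s, 'p) item set \<Rightarrow> bool" where
  "covered G I I' \<longleftrightarrow> (\<forall>y\<in>I'. wf_item G y) \<and> PInit G \<subseteq> I \<and> Norm I' \<subseteq> items_bar G I"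

lemma coveredI:
  assumes "\<And>q d i j. (q, d, i, j) \<in> I' \<Longrightarrow> wf_item G (q, d, i, j)" and "PInit G \<subseteq> I"
    and "\<And>q d i j. (q, d, i, j) \<in> I' \<Longrightarrow> fst q \<noteq> Top \<Longrightarrow> d \<le> length (snd q) \<Longrightarrow>
      drop d (snd q) \<noteq> [Bot] \<Longrightarrow> \<exists>r \<rho>. (r, d, i, j, \<rho>) \<in> I \<and> q \<in> item_rules G r d \<rho>"
  shows "covered G I I'"
  unfolding covered_def
proof (intro conjI ballI subsetI)
  fix y assume "y \<in> I'"
  then show "wf_item G y" using assms(1) by (cases y) blast
next
  fix y assume y: "y \<in> Norm I'"
  obtain q d i j where [simp]: "y = (q, d, i, j)" by (cases y)
  show "y \<in> items_bar G I" using assms(3)[of q d i j] y by (simp add: Norm_iff items_bar_iff)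
qed (use assms(2) in blast)

lemma coveredD:
  assumes "covered G I I'"
  shows "(q, d, i, j) \<in> I' \<Longrightarrow> wf_item G (q, d, i, j)" "PInit G \<subseteq> I"
    and "(q, d, i, j) \<in> I' \<Longrightarrow> fst q \<noteq> Top \<Longrightarrow> d \<le> length (snd q) \<Longrightarrow>
      drop d (snd q) \<noteq> [Bot] \<Longrightarrow> \<exists>r \<rho>. (r, d, i, j, \<rho>) \<in> I \<and> q \<in> item_rules G r d \<rho>"
proof -
  show "wf_item G (q, d, i, j)" if "(q, d, i, j) \<in> I'"
    using assms that unfolding covered_def by blast
  show "PInit G \<subseteq> I" using assms unfolding covered_def by blast
  assume "(q, d, i, j) \<in> I'" "fst q \<noteq> Top" "d \<le> length (snd q)" "drop d (snd q) \<noteq> [Bot]"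
  then have "(q, d, i, j) \<in> Norm I'" by (simp add: Norm_iff)
  then have "(q, d, i, j) \<in> items_bar G I" using assms unfolding covered_def by blast
  then show "\<exists>r \<rho>. (r, d, i, j, \<rho>) \<in> I \<and> q \<in> item_rules G r d \<rho>" by (simp only: items_bar_iff)
qed

text \<open>A next symbol other than \<open>Bot\<close> rules out the remainder
  \<open>[Bot]\<close>, so the item survives \<open>Norm\<close>.\<close>

lemma covered_nextD:
  assumes "covered G I I'" "(q, d, i, j) \<in> I'" "fst q \<noteq> Top" "d < length (snd q)"
    "snd q ! d \<noteq> Bot"
  obtains r \<rho> where "(r, d, i, j, \<rho>) \<in> I" "q \<in> item_rules G r d \<rho>"
proof -
  have "drop d (snd q) = snd q ! d # drop (Suc d) (snd q)"
    using assms(4) by (simp add: Cons_nth_drop_Suc)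
  then have "drop d (snd q) \<noteq> [Bot]" using assms(5) by simp
  then obtain r \<rho> where "(r, d, i, j, \<rho>) \<in> I" "q \<in> item_rules G r d \<rho>"
    using coveredD(3)[OF assms(1-3)] assms(4) by (metis less_imp_le)
  then show thesis by (rule that)
qed

lemma covered_UN:
  assumes "\<And>n::nat. covered G (A n) (B n)"
  shows "covered G (\<Union>n. A n) (\<Union>n. B n)"
proof (rule coveredI)
  fix q d i j assume "(q, d, i, j) \<in> (\<Union>n. B n)"
  then obtain n where n: "(q, d, i, j) \<in> B n" by blast
  show "wf_item G (q, d, i, j)" using coveredD(1)[OF assms n] .
  assume "fst q \<noteq> Top" "d \<le> length (snd q)" "drop d (snd q) \<noteq> [Bot]"
  from coveredD(3)[OF assms n this]
  show "\<exists>r \<rho>. (r, d, i, j, \<rho>) \<in> (\<Union>n. A n) \<and> q \<in> item_rules G r d \<rho>" by blast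
next
  have "PInit G \<subseteq> A 0" using assms by (rule coveredD(2))
  then show "PInit G \<subseteq> (\<Union>n. A n)" by blast
qed

lemma simI: "covers G I I' \<Longrightarrow> covered G I I' \<Longrightarrow> sim G I I'"
  unfolding sim_def covers_def covered_def by blast

lemma inj_untag: "inj untag"
  by (rule injI) (auto elim!: untag.elims)

text \<open>Both iterations run in lockstep: \<open>R\<close> holds after each number of rounds, and
  closure under unions carries it to the limits.\<close>

lemma limit_rel:
  assumes "R X Y" "\<And>X Y. R X Y \<Longrightarrow> R (f X) (g Y)"
    and "\<And>A B. (\<And>n::nat. R (A n) (B n)) \<Longrightarrow> R (\<Union>n. A n) (\<Union>n. B n)"
  shows "R (limit f X) (limit g Y)"
proof -
  have "R ((f ^^ n) X) ((g ^^ n) Y)" for n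
    by (induction n) (simp_all add: assms(1,2))
  then show ?thesis unfolding limit_def by (rule assms(3))
qed

subsection \<open>From PELLA to ELLA\<close>

context
  fixes G :: "('s, 'p, 'c) pll"
  assumes pll: "parameterized_local_lexing G"
begin

lemma wf_rule: "r \<in> Rules G \<Longrightarrow> wf_prule G r"
  using pll by (auto simp: parameterized_local_lexing_def)

text \<open>An induced rule of the predicted item has some lower parameter \<beta> on its left side.
  The predicting ELLA item must show the same \<beta> behind its dot, and
  \<open>item_rules_next\<close> provides such an item.\<close>

lemma covers_predict:
  assumes "covers G I I'"
  shows "covers G (PPredict G k I) (EPredict G k I')"
proof -
  have old: "(q, d, i, j) \<in> EPredict G k I'"
    if "(r, d, i, j, \<rho>) \<in> I" "q \<in> item_rules G r d \<rho>" for r d i j \<rho> q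
    using that coversD[OF assms] by (simp add: EPredict_iff)
  have new: "(q, 0, k, k) \<in> EPredict G k I'"
    if x: "(r, d, i, k, \<rho>) \<in> I" "d < arity r" and r': "r' \<in> Rules G" "syms r ! d = lhs r'"
      and q: "q \<in> item_rules G r' 0 [\<rho> ! (2 * d + 1), a]" for r r' d i \<rho> a q
  proof -
    obtain \<beta> where \<beta>: "\<beta> \<in> Phi G" "fst q = Sym (lhs r') (\<rho> ! (2 * d + 1)) \<beta>"
      using item_rules_fst[OF q] by auto
    have wf: "wf_pitem G (r, d, i, k, \<rho>)" using coversD(1)[OF assms x(1)] .
    then have "wf_prule G r" using wf_rule by simp
    then obtain p where p: "p \<in> item_rules G r d \<rho>" "d < length (snd p)"
      "snd p ! d = Sym (syms r ! d) (\<rho> ! (2 * d + 1)) \<beta>"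
      using item_rules_next[OF _ wf x(2) \<beta>(1)] by blast
    obtain L v where Lv: "p = (L, v)" by fastforce
    have "((L, v), d, i, k) \<in> I'" using coversD(2)[OF assms x(1) p(1)] Lv by simp
    moreover have "d < length v" "v ! d = fst q" using p(2,3) \<beta>(2) r'(2) Lv by simp_all
    ultimately show ?thesis
      using item_rules_Rules_bar[OF q r'(1)] unfolding EPredict_iff by blast
  qed
  show ?thesis
    by (rule coversI; (unfold PPredict_def)?)
      (use old new wf_pitem_0I[OF _ wf_rule] coversD(1)[OF assms] in \<open>auto simp del: wf_pitem.simps\<close>)
qed

lemma covers_complete:
  assumes "covers G I I'"
  shows "covers G (PComplete k I) (EComplete k I')"
proof -
  have old: "(q, d, i, j) \<in> EComplete k I'"
    if "(r, d, i, j, \<rho>) \<in> I" "q \<in> item_rules G r d \<rho>" for r d i j \<rho> q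
    using that coversD[OF assms] by (simp add: EComplete_iff)
  have new: "(q, Suc d, i, k) \<in> EComplete k I'"
    if x: "(r, d, i, j, \<rho>) \<in> I" and y: "(r', arity r', j, k, \<xi>) \<in> I"
      and s: "syms r ! d = lhs r'" "\<rho> ! (2 * d + 1) = \<xi> ! 0"
      and q: "q \<in> item_rules G r (Suc d) (\<rho> @ [\<xi> ! (2 * arity r' + 1), a])" for r r' d i j \<rho> \<xi> a q
  proof -
    have "length \<rho> = 2 * d + 2" using wf_pitem_length coversD(1)[OF assms x] .
    note q' = item_rules_SucD[OF q this]
    have "(q, d, i, j) \<in> I'" using coversD(2)[OF assms x q'(1)] .
    \<comment> \<open>The completed item is \<open>rule_i r' \<xi>\<close>; its left side agrees
      with the symbol that \<open>item_rules_SucD\<close> reads off from \<open>q\<close>.\<close>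
    moreover have "((snd q ! d, decorate (syms r') \<xi>), arity r', j, k) \<in> I'"
      using coversD[OF assms y] wf_pitem_full[of G r' j k \<xi>] q'(3) s by metis
    ultimately show ?thesis using q'(2) unfolding EComplete_iff by (metis length_decorate)
  qed
  have wf: "wf_pitem G (r, Suc d, i', k, \<rho> @ [b, a])"
    if "(r, d, i, j, \<rho>) \<in> I" "d < arity r" "(pfuns r ! Suc d) (\<rho> @ [b]) = Some a" for r d i i' j \<rho> b a
    using that coversD(1)[OF assms that(1)] wf_pitem_SucI wf_rule wf_pitem.simps by metis
  show ?thesis
    by (rule coversI; (unfold PComplete_def)?)
      (use old new wf coversD(1)[OF assms] in \<open>auto simp del: wf_pitem.simps\<close>)
qed

lemma covers_scan:
  assumes "covers G I I'"
  shows "covers G (PScan T k I) (EScan (untag ` T) k I')"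
proof -
  have old: "(q, d, i, j) \<in> EScan (untag ` T) k I'"
    if "(r, d, i, j, \<rho>) \<in> I" "q \<in> item_rules G r d \<rho>" for r d i j \<rho> q
    using that coversD[OF assms] by (simp add: EScan_iff)
  have new: "(q, Suc d, i, k + length c) \<in> EScan (untag ` T) k I'"
    if x: "(r, d, i, k, \<rho>) \<in> I" and t: "(syms r ! d, \<rho> ! (2 * d + 1), b, c) \<in> T"
      and q: "q \<in> item_rules G r (Suc d) (\<rho> @ [b, a])" for r d i \<rho> b c a q
  proof -
    have "length \<rho> = 2 * d + 2" using wf_pitem_length coversD(1)[OF assms x] .
    note q' = item_rules_SucD[OF q this]
    have "(q, d, i, k) \<in> I'" using coversD(2)[OF assms x q'(1)] .
    moreover have "(snd q ! d, c) \<in> untag ` T" using imageI[OF t, of untag] q'(3) by simp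
    ultimately show ?thesis using q'(2) unfolding EScan_iff by metis
  qed
  have wf: "wf_pitem G (r, Suc d, i', j', \<rho> @ [b, a])"
    if "(r, d, i, j, \<rho>) \<in> I" "d < arity r" "(pfuns r ! Suc d) (\<rho> @ [b]) = Some a"
    for r d i i' j j' \<rho> b a
    using that coversD(1)[OF assms that(1)] wf_pitem_SucI wf_rule wf_pitem.simps by metis
  show ?thesis
    by (rule coversI; (unfold PScan_def)?)
      (use old new wf coversD(1)[OF assms] in \<open>auto simp del: wf_pitem.simps\<close>)
qed

text \<open>A rule whose left side has lower parameter \<beta> is predicted by the
  \<open>Top\<close> rule with that same \<beta>.\<close>

lemma covers_init: "covers G (PInit G) (EPredict G 0 (EInit G))"
proof (rule coversI)
  fix r d i j \<rho> q assume x: "(r, d, i, j, \<rho>) \<in> PInit G" and q: "q \<in> item_rules G r d \<rho>"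
  obtain \<beta> where \<beta>: "\<beta> \<in> Phi G" "fst q = Sym (lhs r) (hd \<rho>) \<beta>"
    using item_rules_fst[OF q] by auto
  have "((Top, [Sym (Start G) (phi_start G) \<beta>]), 0, 0, 0) \<in> EInit G"
    using \<beta> by (simp add: EInit_def Rules_bar_Top)
  moreover have "q \<in> Rules_bar G"
    using item_rules_Rules_bar[OF q] x by (auto simp: PInit_def)
  ultimately show "(q, d, i, j) \<in> EPredict G 0 (EInit G)"
    using x \<beta> unfolding EPredict_iff PInit_def by fastforce
qed (auto simp: PInit_def intro!: wf_pitem_0I wf_rule simp del: wf_pitem.simps)

subsection \<open>From ELLA to PELLA\<close>

lemma covered_predict:
  assumes "covered G I I'"
  shows "covered G (PPredict G k I) (EPredict G k I')"
proof (rule coveredI)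
  fix q d i j assume y: "(q, d, i, j) \<in> EPredict G k I'"
  have "fst q \<noteq> Top" if "((L, v), e, m, k) \<in> I'" "e < length v" "v ! e = fst q" for L v e m
    using Rules_bar_rhs_Top[of L v G e] coveredD(1)[OF assms that(1)] that by auto
  moreover have "q \<in> Rules_bar G \<and> (fst q = Top \<longrightarrow> d = 0 \<longrightarrow> j = 0)" if "(q, d, i, j) \<in> I'"
    using coveredD(1)[OF assms that] by simp
  ultimately show "wf_item G (q, d, i, j)"
    using y unfolding EPredict_iff wf_item.simps by blast
next
  show "PInit G \<subseteq> PPredict G k I" using coveredD(2)[OF assms] by (auto simp: PPredict_def)
next
  fix q d i j
  assume y: "(q, d, i, j) \<in> EPredict G k I'" "fst q \<noteq> Top" "d \<le> length (snd q)"
    "drop d (snd q) \<noteq> [Bot]"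
  show "\<exists>r \<rho>. (r, d, i, j, \<rho>) \<in> PPredict G k I \<and> q \<in> item_rules G r d \<rho>"
  proof (cases "(q, d, i, j) \<in> I'")
    case True
    then show ?thesis using coveredD(3)[OF assms True y(2-4)] unfolding PPredict_def by blast
  next
    case False
    then obtain L v e m where [simp]: "d = 0" "i = k" "j = k" and q: "q \<in> Rules_bar G"
      and x: "((L, v), e, m, k) \<in> I'" "e < length v" "v ! e = fst q"
      using y(1) unfolding EPredict_iff by blast
    obtain r where r: "r \<in> Rules G" "q \<in> rule_bar G r"
      using q y(2) Rules_bar_cases by (metis prod.collapse)
    obtain \<alpha> \<beta> a where a: "fst q = Sym (lhs r) \<alpha> \<beta>" "(pfuns r ! 0) [\<alpha>] = Some a"
      "q \<in> item_rules G r 0 [\<alpha>, a]" using rule_barE[OF r(2)] .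
    have "(r, 0, k, k, [\<alpha>, a]) \<in> PPredict G k I"
    proof (cases "L = Top")
      case True
      have wf: "wf_item G ((L, v), e, m, k)" using coveredD(1)[OF assms x(1)] .
      then have "(Top, v) \<in> Rules_bar G" using True by simp
      then obtain \<gamma> where v: "v = [Sym (Start G) (phi_start G) \<gamma>]" by (auto simp: Rules_bar_Top)
      \<comment> \<open>The right side has a single symbol, so the dot is at 0 and
        \<open>wf_item\<close> forces the position to be 0.\<close>
      then have "e = 0" "k = 0" using True wf x(2) by auto
      then have "(r, 0, k, k, [\<alpha>, a]) \<in> PInit G"
        using r(1) a x(3) v by (simp add: PInit_def)
      then show ?thesis using coveredD(2)[OF assms] by (auto simp: PPredict_def)
    next
      case False
      obtain r1 \<rho> where p: "(r1, e, m, k, \<rho>) \<in> I" "(L, v) \<in> item_rules G r1 e \<rho>"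
        using covered_nextD[OF assms x(1)] False x a(1) by auto
      have "snd (L, v) ! e = Sym (lhs r) \<alpha> \<beta>" "e < length (snd (L, v))" using x a(1) by auto
      note n = item_rules_nextD(1-3)[OF p(2) this(2,1)]
      show ?thesis unfolding PPredict_def using p(1) n r(1) a(2) by blast
    qed
    then show ?thesis using a(3) by auto
  qed
qed

lemma covered_complete:
  assumes "covered G I I'"
  shows "covered G (PComplete k I) (EComplete k I')"
proof (rule coveredI)
  fix q d i j assume y: "(q, d, i, j) \<in> EComplete k I'"
  \<comment> \<open>An advanced item has a positive dot position, which makes the condition on
    \<open>Top\<close> items vacuous for it.\<close>
  have "q \<in> Rules_bar G \<and> (fst q = Top \<longrightarrow> e = 0 \<longrightarrow> m = 0)" if "(q, e, i, m) \<in> I'" for e m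
    using coveredD(1)[OF assms that] by simp
  then show "wf_item G (q, d, i, j)"
    using y unfolding EComplete_iff wf_item.simps by blast
next
  show "PInit G \<subseteq> PComplete k I" using coveredD(2)[OF assms] by (auto simp: PComplete_def)
next
  fix q d i j
  assume y: "(q, d, i, j) \<in> EComplete k I'" "fst q \<noteq> Top" "d \<le> length (snd q)"
    "drop d (snd q) \<noteq> [Bot]"
  show "\<exists>r \<rho>. (r, d, i, j, \<rho>) \<in> PComplete k I \<and> q \<in> item_rules G r d \<rho>"
  proof (cases "(q, d, i, j) \<in> I'")
    case True
    then show ?thesis using coveredD(3)[OF assms True y(2-4)] unfolding PComplete_def by blast
  next
    case False
    then obtain e m w where [simp]: "d = Suc e" "j = k" and x: "(q, e, i, m) \<in> I'" "e < length (snd q)"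
      and z: "((snd q ! e, w), length w, m, k) \<in> I'"
      using y(1) unfolding EComplete_iff by blast
    have "(snd q ! e, w) \<in> Rules_bar G" using coveredD(1)[OF assms z] by simp
    then have "snd q ! e \<noteq> Bot" using Rules_bar_lhs_Bot by metis
    then obtain r \<rho> where p: "(r, e, i, m, \<rho>) \<in> I" "q \<in> item_rules G r e \<rho>"
      using covered_nextD[OF assms x(1) y(2) x(2)] by blast
    have "(fst q, snd q) \<in> Rules_bar G" using coveredD(1)[OF assms x(1)] by simp
    \<comment> \<open>Hence the completed item survives \<open>Norm\<close>, as nothing remains
      behind its dot, and it has a counterpart in \<open>I\<close>.\<close>
    then have "snd q ! e \<noteq> Top" using Rules_bar_rhs_Top x(2) by metis
    then obtain r' \<xi> where c: "(r', length w, m, k, \<xi>) \<in> I"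
      "(snd q ! e, w) \<in> item_rules G r' (length w) \<xi>"
      using coveredD(3)[OF assms z] by auto
    have full: "length w = arity r'"
      "snd q ! e = Sym (lhs r') (\<xi> ! 0) (\<xi> ! (2 * length w + 1))"
      using item_rules_full[OF c(2)] by simp_all
    note n = item_rules_nextD[OF p(2) x(2) full(2)]
    \<comment> \<open>The advanced item is not in front of a final \<open>Bot\<close>, so the next
      function is defined.\<close>
    obtain a where a: "(pfuns r ! Suc e) (\<rho> @ [\<xi> ! (2 * length w + 1)]) = Some a"
      "q \<in> item_rules G r (Suc e) (\<rho> @ [\<xi> ! (2 * length w + 1), a])"
      using n(4) y(4) by auto
    have "(r, e + 1, i, k, (\<rho> @ [\<xi> ! (2 * length w + 1)]) @ [a]) \<in> PComplete k I"
      unfolding PComplete_def using p(1) n(1-3) c(1) full(1) a(1) by fastforce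
    then show ?thesis using a(2) by auto
  qed
qed

lemma covered_scan:
  assumes "covered G I I'"
  shows "covered G (PScan T k I) (EScan (untag ` T) k I')"
proof (rule coveredI)
  fix q d i j assume y: "(q, d, i, j) \<in> EScan (untag ` T) k I'"
  have "q \<in> Rules_bar G \<and> (fst q = Top \<longrightarrow> e = 0 \<longrightarrow> m = 0)" if "(q, e, i, m) \<in> I'" for e m
    using coveredD(1)[OF assms that] by simp
  then show "wf_item G (q, d, i, j)"
    using y unfolding EScan_iff wf_item.simps by blast
next
  show "PInit G \<subseteq> PScan T k I" using coveredD(2)[OF assms] by (auto simp: PScan_def)
next
  fix q d i j
  assume y: "(q, d, i, j) \<in> EScan (untag ` T) k I'" "fst q \<noteq> Top" "d \<le> length (snd q)"
    "drop d (snd q) \<noteq> [Bot]"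
  show "\<exists>r \<rho>. (r, d, i, j, \<rho>) \<in> PScan T k I \<and> q \<in> item_rules G r d \<rho>"
  proof (cases "(q, d, i, j) \<in> I'")
    case True
    then show ?thesis using coveredD(3)[OF assms True y(2-4)] unfolding PScan_def by blast
  next
    case False
    then obtain e c where [simp]: "d = Suc e" "j = k + length c"
      and x: "(q, e, i, k) \<in> I'" "e < length (snd q)" and "(snd q ! e, c) \<in> untag ` T"
      using y(1) unfolding EScan_iff by blast
    \<comment> \<open>Tokens in the image of \<open>untag\<close> carry a \<open>Sym\<close>, so the
      symbol scanned is not \<open>Bot\<close>.\<close>
    then obtain t \<alpha> \<beta> where t: "snd q ! e = Sym t \<alpha> \<beta>" "(t, \<alpha>, \<beta>, c) \<in> T" by auto
    then obtain r \<rho> where p: "(r, e, i, k, \<rho>) \<in> I" "q \<in> item_rules G r e \<rho>"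
      using covered_nextD[OF assms x(1) y(2) x(2)] by auto
    note n = item_rules_nextD[OF p(2) x(2) t(1)]
    obtain a where a: "(pfuns r ! Suc e) (\<rho> @ [\<beta>]) = Some a"
      "q \<in> item_rules G r (Suc e) (\<rho> @ [\<beta>, a])"
      using n(4) y(4) by auto
    have "(r, e + 1, i, k + length c, (\<rho> @ [\<beta>]) @ [a]) \<in> PScan T k I"
      unfolding PScan_def using p(1) n(1-3) t(2) a(1) by fastforce
    then show ?thesis using a(2) by auto
  qed
qed

text \<open>All items of \<open>EInit G\<close> have left side \<open>Top\<close>, so
  \<open>Norm\<close> leaves nothing to cover.\<close>

lemma covered_init: "covered G (PInit G) (EInit G)"
  by (rule coveredI) (auto simp: EInit_def)

subsection \<open>Tokens\<close>

text \<open>\<open>Sel_bar\<close> applies \<open>Sel\<close> to preimages under the injective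
  \<open>untag\<close>, so it suffices that the preimage of the ELLA candidates is the set of PELLA
  candidates.\<close>

lemma tokens_eq:
  assumes "covers G I I'" "covered G I I'" "D \<in> lists (Chars G)" "k \<le> length D"
  shows "ETokens G D (untag ` T) k I' = untag ` PTokens G D T k I"
proof -
  let ?B = "{x. \<exists>r d i \<rho>. (r, d, i, k, \<rho>) \<in> I \<and> d < arity r \<and> syms r ! d \<in> Terms G \<and>
    x \<in> Lex G (syms r ! d) (\<rho> ! (2 * d + 1)) D k}"
  let ?B' = "{x. \<exists>q d i. (q, d, i, k) \<in> I' \<and> d < length (snd q) \<and> snd q ! d \<in> Terms_bar G \<and>
    x \<in> Lex_bar G (snd q ! d) D k}"
  have "untag -` ?B' = ?B"
  proof (intro equalityI subsetI)
    fix x assume "x \<in> ?B"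
    then obtain r d i \<rho> where x: "(r, d, i, k, \<rho>) \<in> I" "d < arity r" "syms r ! d \<in> Terms G"
      "x \<in> Lex G (syms r ! d) (\<rho> ! (2 * d + 1)) D k" by blast
    let ?t = "syms r ! d" and ?\<alpha> = "\<rho> ! (2 * d + 1)"
    have wf: "wf_pitem G (r, d, i, k, \<rho>)" using coversD(1)[OF assms(1) x(1)] .
    then have "?\<alpha> \<in> Phi G" using nth_mem[of "2 * d + 1" \<rho>] by (auto simp: angle_iff)
    then have "Lex G ?t ?\<alpha> D k \<subseteq> {(?t, ?\<alpha>, \<beta>, c) | \<beta> c. (?t, ?\<alpha>, \<beta>, c) \<in> ptokens G \<and>
        k + length c \<le> length D \<and> (\<forall>i<length c. c ! i = D ! (k + i))}"
      using pll x(3) assms(3,4) unfolding parameterized_local_lexing_def by blast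
    \<comment> \<open>The lexer guarantees that \<beta> lies in \<open>Phi G\<close>, so some ELLA
      item has exactly this token's symbol behind its dot.\<close>
    then obtain \<beta> c where xc: "x = (?t, ?\<alpha>, \<beta>, c)" and \<beta>: "\<beta> \<in> Phi G"
      using x(4) unfolding ptokens_def by blast
    have "wf_prule G r" using wf wf_rule by simp
    then obtain p where p: "p \<in> item_rules G r d \<rho>" "d < length (snd p)" "snd p ! d = Sym ?t ?\<alpha> \<beta>"
      using item_rules_next[OF _ wf x(2) \<beta>] by blast
    have "(p, d, i, k) \<in> I'" using coversD(2)[OF assms(1) x(1) p(1)] .
    moreover have "snd p ! d \<in> Terms_bar G"
      using p(3) x(3) \<open>?\<alpha> \<in> Phi G\<close> \<beta> by (simp add: Terms_bar_def)
    moreover have "untag x \<in> Lex_bar G (snd p ! d) D k" using p(3) x(4) xc by simp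
    ultimately show "x \<in> untag -` ?B'" using p(2) by blast
  next
    fix x assume "x \<in> untag -` ?B'"
    then obtain q d i where q: "(q, d, i, k) \<in> I'" "d < length (snd q)" "snd q ! d \<in> Terms_bar G"
      "untag x \<in> Lex_bar G (snd q ! d) D k" by blast
    then obtain t \<alpha> \<beta> where t: "snd q ! d = Sym t \<alpha> \<beta>" "t \<in> Terms G" by (auto simp: Terms_bar_def)
    \<comment> \<open>A \<open>Top\<close> item can only be followed by the start symbol, which is a
      nonterminal.\<close>
    have "fst q \<noteq> Top"
    proof
      assume "fst q = Top"
      then have "(Top, snd q) \<in> Rules_bar G"
        using coveredD(1)[OF assms(2) q(1)] by (metis prod.collapse wf_item.simps)
      then have "t = Start G" using q(2) t(1) by (auto simp: Rules_bar_Top)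
      then show False using pll t(2) by (auto simp: parameterized_local_lexing_def)
    qed
    then obtain r \<rho> where p: "(r, d, i, k, \<rho>) \<in> I" "q \<in> item_rules G r d \<rho>"
      using covered_nextD[OF assms(2) q(1) _ q(2)] t(1) by auto
    note n = item_rules_nextD(1-3)[OF p(2) q(2) t(1)]
    have "x \<in> Lex G t \<alpha> D k" using q(4) t(1) by (cases x) auto
    then show "x \<in> ?B" using p(1) n t(2) by blast
  qed
  moreover have "untag -` (untag ` T) = T" by (simp add: inj_vimage_image_eq inj_untag)
  ultimately show ?thesis by (simp add: ETokens_eq PTokens_def Sel_bar_def)
qed

subsection \<open>Iteration\<close>

lemma covers_pi:
  assumes "covers G I I'"
  shows "covers G (pi_step (pella G D) k T I) (pi_step (ella G D) k (untag ` T) I')"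
  unfolding pi_step_def pella_def ella_def steps.simps
proof (rule limit_rel[where R = "covers G"])
  fix X X' assume XX': "covers G X X'"
  show "covers G ((PScan T k \<circ> PComplete k \<circ> PPredict G k) X)
    ((EScan (untag ` T) k \<circ> EComplete k \<circ> EPredict G k) X')"
    unfolding comp_apply by (fact covers_scan[OF covers_complete[OF covers_predict[OF XX']]])
next
  fix A B :: "nat \<Rightarrow> _" assume "\<And>n. covers G (A n) (B n)"
  then show "covers G (\<Union>n. A n) (\<Union>n. B n)" by (rule covers_UN)
qed (fact assms)

lemma covered_pi:
  assumes "covered G I I'"
  shows "covered G (pi_step (pella G D) k T I) (pi_step (ella G D) k (untag ` T) I')"
  unfolding pi_step_def pella_def ella_def steps.simps
proof (rule limit_rel[where R = "covered G"])
  fix X X' assume XX': "covered G X X'"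
  show "covered G ((PScan T k \<circ> PComplete k \<circ> PPredict G k) X)
    ((EScan (untag ` T) k \<circ> EComplete k \<circ> EPredict G k) X')"
    unfolding comp_apply by (fact covered_scan[OF covered_complete[OF covered_predict[OF XX']]])
next
  fix A B :: "nat \<Rightarrow> _" assume "\<And>n. covered G (A n) (B n)"
  then show "covered G (\<Union>n. A n) (\<Union>n. B n)" by (rule covered_UN)
qed (fact assms)

text \<open>PELLA starting from \<open>PInit G\<close> is compared with ELLA starting one round
  later, after the first prediction. The head start does not enlarge the limit.\<close>

lemma covers_pi_init:
  "covers G (pi_step (pella G D) 0 {} (PInit G)) (pi_step (ella G D) 0 {} (EInit G))"
proof -
  let ?f = "step_scan (ella G D) {} 0 \<circ> step_complete (ella G D) 0 \<circ> step_predict (ella G D) 0"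
  \<comment> \<open>Completion and scanning only add items.\<close>
  have "EPredict G 0 (EInit G) \<subseteq> ?f (EInit G)"
    by (auto simp: ella_def EScan_def EComplete_def)
  from covers_mono[OF covers_init this]
  have *: "covers G (pi_step (pella G D) 0 {} (PInit G)) (limit ?f (?f (EInit G)))"
    using covers_pi[of "PInit G" "?f (EInit G)" D 0 "{}"]
    unfolding image_empty pi_step_def[of "ella G D"] by blast
  have "(?f ^^ n) (?f (EInit G)) = (?f ^^ Suc n) (EInit G)" for n
    by (simp only: funpow_Suc_right comp_apply)
  then have "(?f ^^ n) (?f (EInit G)) \<subseteq> limit ?f (EInit G)" for n
    unfolding limit_def by (metis UN_upper UNIV_I)
  then have "limit ?f (?f (EInit G)) \<subseteq> limit ?f (EInit G)"
    unfolding limit_def[of _ "?f (EInit G)"] by (rule UN_least)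
  from covers_mono[OF * this] show ?thesis unfolding pi_step_def[of "ella G D"] .
qed

text \<open>The claims are proved together because equal token sets rest on both inclusions, and the
  next round of either inclusion uses the equal token sets. The induction on \<open>u\<close> runs
  inside the one on \<open>k\<close>.\<close>

lemma J_T_sets:
  assumes D: "D \<in> lists (Chars G)" and "k \<le> length D"
  shows "covers G (J_set (pella G D) k u) (J_set (ella G D) k u) \<and>
    covered G (J_set (pella G D) k u) (J_set (ella G D) k u) \<and>
    T_set (ella G D) k u = untag ` T_set (pella G D) k u"
  using assms(2)
proof (induction k arbitrary: u)
  case 0
  show ?case
  proof (induction u)
    case 0
    have "step_init (pella G D) = PInit G" "step_init (ella G D) = EInit G"
      by (simp_all add: pella_def ella_def)
    then show ?case
      using covers_pi_init covered_pi[OF covered_init, of D 0 "{}"] by simp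
  next
    case (Suc u)
    then have IH: "covers G (J_set (pella G D) 0 u) (J_set (ella G D) 0 u)"
      "covered G (J_set (pella G D) 0 u) (J_set (ella G D) 0 u)"
      "T_set (ella G D) 0 u = untag ` T_set (pella G D) 0 u" by blast+
    have T: "T_set (ella G D) 0 (Suc u) = untag ` T_set (pella G D) 0 (Suc u)"
      using tokens_eq[OF IH(1,2) D, where T = "T_set (pella G D) 0 u"] IH(3)
      by (simp add: pella_def ella_def)
    show ?case
      using covers_pi[OF IH(1), of D "0" "T_set (pella G D) 0 (Suc u)"]
        covered_pi[OF IH(2), of D "0" "T_set (pella G D) 0 (Suc u)"] T
      by (simp del: T_set.simps)
  qed
next
  case (Suc k)
  show ?case
  proof (induction u)
    case 0
    \<comment> \<open>Knowing both relations for every \<open>u\<close> at position \<open>k\<close>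
      allows passing to the unions from which position \<open>Suc k\<close> starts.\<close>
    have IH: "covers G (J_set (pella G D) k u) (J_set (ella G D) k u)"
      "covered G (J_set (pella G D) k u) (J_set (ella G D) k u)" for u
      using Suc.IH[of u] Suc.prems by simp_all
    show ?case
      using covers_pi[OF covers_UN[OF IH(1)], of D "Suc k" "{}"]
        covered_pi[OF covered_UN[OF IH(2)], of D "Suc k" "{}"] by simp
  next
    case (Suc u)
    then have IH: "covers G (J_set (pella G D) (Suc k) u) (J_set (ella G D) (Suc k) u)"
      "covered G (J_set (pella G D) (Suc k) u) (J_set (ella G D) (Suc k) u)"
      "T_set (ella G D) (Suc k) u = untag ` T_set (pella G D) (Suc k) u" by blast+
    have T: "T_set (ella G D) (Suc k) (Suc u) = untag ` T_set (pella G D) (Suc k) (Suc u)"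
      using tokens_eq[OF IH(1,2) D \<open>Suc k \<le> length D\<close>, where T = "T_set (pella G D) (Suc k) u"] IH(3)
      by (simp add: pella_def ella_def)
    show ?case
      using covers_pi[OF IH(1), of D "Suc k" "T_set (pella G D) (Suc k) (Suc u)"]
        covered_pi[OF IH(2), of D "Suc k" "T_set (pella G D) (Suc k) (Suc u)"] T
      by (simp del: T_set.simps)
  qed
qed

lemma sim_I_set:
  assumes "D \<in> lists (Chars G)" "k \<le> length D"
  shows "sim G (I_set (pella G D) k) (I_set (ella G D) k)"
  using J_T_sets[OF assms] unfolding I_set_def by (intro simI covers_UN covered_UN) auto

end

theorem theorem17:
  fixes G :: "('s, 'p, 'c) pll" and D :: "'c list"
  assumes "parameterized_local_lexing G"
    and "D \<in> lists (Chars G)"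
  shows "(\<forall>k\<le>length D. \<forall>u.
            sim G (J_set (pella G D) k u) (J_set (ella G D) k u) \<and>
            untag ` T_set (pella G D) k u = T_set (ella G D) k u \<and>
            sim G (I_set (pella G D) k) (I_set (ella G D) k)) \<and>
         sim G (result_set (pella G D) D) (result_set (ella G D) D)"
  using J_T_sets[OF assms] simI[of G] sim_I_set[OF assms]
  unfolding result_set_def by (metis order_refl)

end
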